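(* Let $(\mathcal M,g)$ be a spacetime admitting a future conformal completion $\widetilde{\mathcal M}=\mathcal M\cup\mathscr I^+$, where $\mathscr I^+$ is a connected (in particular non-empty) null hypersurface. Suppose that $$\widetilde{\mathcal D}:=\mathcal D\cup\mathscr I^+,\qquad\text{where } \mathcal D:=I^-(\mathscr I^+)\cap\mathcal M,$$ is globally hyperbolic, and that the null energy condition holds on $\mathcal D$, i.e. $\mathrm{Ric}(X,X)\ge0$ for all null vectors $X$ at points of $\mathcal D$. Then for any compact set $K\subset\mathcal D$, the set $J^+(K,\widetilde{\mathcal D})$ does not contain all of $\mathscr I^+$.
   Context: A conformal completion at infinity of a spacetime $(\mathcal M,g)$ is a pair $(\widetilde{\mathcal M},\tilde g)$, where $\widetilde{\mathcal M}$ is a manifold with boundary such that: (1) $\mathcal M$ is the interior of $\widetilde{\mathcal M}$; (2) there is a function $\Omega$ on $\widetilde{\mathcal M}$ such that the metric $\tilde g$, defined as $\Omega^2 g$ on $\mathcal M$, extends by continuity to the boundary of $\widetilde{\mathcal M}$, with the extended metric keeping its (Lorentzian) signature on the boundary; (3) $\Omega$ is strictly positive on $\mathcal M$, differentiable on $\widetilde{\mathcal M}$, vanishes precisely on $\mathscr I:=\partial\widetilde{\mathcal M}$, and $d\Omega$ is nowhere vanishing on $\mathscr I$. For simplicity both $g$ (on $\mathcal M$) and $\tilde g$ (up to boundary) are assumed smooth. One sets $\mathscr I^+:=\mathscr I\cap J^+(\mathcal M)$; the completion is a future conformal completion when $\widetilde{\mathcal M}=\mathcal M\cup\mathscr I^+$.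 Causal notions in $\widetilde{\mathcal M}$ refer to $\tilde g$. $J^+(K,\widetilde{\mathcal D})$ is the causal future of $K$ within $\widetilde{\mathcal D}$: the union of $K$ with the set of points reachable from $K$ by future-directed causal curves contained in $\widetilde{\mathcal D}$. A spacetime, possibly with boundary, is globally hyperbolic if it is strongly causal and the sets $J^+(p)\cap J^-(q)$ are compact for all $p,q$ (causal futures and pasts taken within the spacetime in question). *)

theory Defs
  imports "HOL-Analysis.Analysis"
begin

section \<open>Smooth manifolds with boundary\<close>

text \<open>
  Manifolds are modelled on the half-space below, so the dimension is \<open>DIM('e) + 1\<close>, an arbitrary
  integer that is at least 2. The points live in an ambient Hausdorff second countable type, and
  the carrier of a manifold is the (open) union of its chart domains. A manifold without boundary
  is one whose boundary is empty; its charts then take values in the open half-space, which is no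
  restriction up to diffeomorphism.
\<close>

definition half_space :: "('e::euclidean_space \<times> real) set" where
  "half_space = {x. 0 \<le> snd x}"

text \<open>The values of \<open>cmap\<close> outside \<open>cdom\<close> are irrelevant.\<close>

datatype ('a, 'c) chart = Chart (cdom: "'a set") (cmap: "'a \<Rightarrow> 'c")

definition cinv :: "('a, 'c) chart \<Rightarrow> 'c \<Rightarrow> 'a" where
  "cinv c = inv_into (cdom c) (cmap c)"

definition cimage :: "('a, 'c) chart \<Rightarrow> 'c set" where
  "cimage c = cmap c ` cdom c"

definition transition :: "('a, 'c) chart \<Rightarrow> ('a, 'c) chart \<Rightarrow> 'c \<Rightarrow> 'c" where
  "transition c d = cmap d \<circ> cinv c"

definition overlap :: "('a, 'c) chart \<Rightarrow> ('a, 'c) chart \<Rightarrow> 'c set" where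
  "overlap c d = cmap c ` (cdom c \<inter> cdom d)"

text \<open>\<open>Ck_on k W f\<close> is the class \<open>C\<^sup>k\<close> on an open set \<open>W\<close>.\<close>

primrec Ck_on ::
  "nat \<Rightarrow> 'c::real_normed_vector set \<Rightarrow> ('c \<Rightarrow> 'd::real_normed_vector) \<Rightarrow> bool" where
  "Ck_on 0 W f = continuous_on W f"
| "Ck_on (Suc k) W f =
     ((\<forall>x\<in>W. f differentiable (at x)) \<and> (\<forall>v. Ck_on k W (\<lambda>x. frechet_derivative f (at x) v)))"

text \<open>On a set that need not be open, smooth means locally extendible to a smooth function.\<close>

definition smooth_on ::
  "'c::real_normed_vector set \<Rightarrow> ('c \<Rightarrow> 'd::real_normed_vector) \<Rightarrow> bool" where
  "smooth_on S f \<longleftrightarrow>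
     (\<forall>x\<in>S. \<exists>W F. open W \<and> x \<in> W \<and> (\<forall>k. Ck_on k W F) \<and> (\<forall>y\<in>W \<inter> S. F y = f y))"

definition is_chart :: "('a::topological_space, 'e::euclidean_space \<times> real) chart \<Rightarrow> bool" where
  "is_chart c \<longleftrightarrow> open (cdom c) \<and> openin (top_of_set half_space) (cimage c) \<and>
     homeomorphism (cdom c) (cimage c) (cmap c) (cinv c)"

definition compatible :: "('a, 'c::real_normed_vector) chart \<Rightarrow> ('a, 'c) chart \<Rightarrow> bool" where
  "compatible c d \<longleftrightarrow>
     smooth_on (overlap c d) (transition c d) \<and> smooth_on (overlap d c) (transition d c)"

definition carrier :: "('a, 'c) chart set \<Rightarrow> 'a set" where
  "carrier A = (\<Union>c\<in>A. cdom c)"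

text \<open>A smooth manifold with boundary is given by its maximal atlas.\<close>

definition smooth_manifold ::
  "('a::{t2_space, second_countable_topology}, 'e::euclidean_space \<times> real) chart set \<Rightarrow> bool" where
  "smooth_manifold A \<longleftrightarrow>
     (\<forall>c\<in>A. is_chart c) \<and> (\<forall>c\<in>A. \<forall>d\<in>A. compatible c d) \<and>
     (\<forall>c. is_chart c \<and> cdom c \<subseteq> carrier A \<and> (\<forall>d\<in>A. compatible c d) \<longrightarrow> c \<in> A)"

definition mboundary :: "('a, 'e \<times> real) chart set \<Rightarrow> 'a set" where
  "mboundary A = {p. \<exists>c\<in>A. p \<in> cdom c \<and> snd (cmap c p) = 0}"

definition minterior :: "('a, 'e \<times> real) chart set \<Rightarrow> 'a set" where
  "minterior A = carrier A - mboundary A"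

text \<open>The maximal atlas that an open subset \<open>M\<close> inherits.\<close>

definition open_submanifold :: "('a, 'c) chart set \<Rightarrow> 'a set \<Rightarrow> ('a, 'c) chart set" where
  "open_submanifold A M = {c\<in>A. cdom c \<subseteq> M}"


section \<open>Tensor fields, Lorentzian metrics, time orientations\<close>

text \<open>
  Tangent vectors at \<open>p\<close> are given by their components in a chart around \<open>p\<close>, and tensor
  fields by a family of components, one for each chart, that obeys the transformation law. The
  derivative within an overlap is unique also at boundary points, because an overlap is relatively
  open in the half-space.
\<close>

type_synonym ('a, 'c) vector_field = "('a, 'c) chart \<Rightarrow> 'a \<Rightarrow> 'c"
type_synonym ('a, 'c) bilinear_field = "('a, 'c) chart \<Rightarrow> 'a \<Rightarrow> 'c \<Rightarrow> 'c \<Rightarrow> real"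

definition transition_derivative ::
  "('a, 'c::real_normed_vector) chart \<Rightarrow> ('a, 'c) chart \<Rightarrow> 'a \<Rightarrow> ('c \<Rightarrow> 'c) \<Rightarrow> bool" where
  "transition_derivative c d p L \<longleftrightarrow>
     (transition c d has_derivative L) (at (cmap c p) within overlap c d)"

definition vector_field_on ::
  "('a, 'c::real_normed_vector) chart set \<Rightarrow> ('a, 'c) vector_field \<Rightarrow> bool" where
  "vector_field_on A X \<longleftrightarrow>
     (\<forall>c\<in>A. \<forall>d\<in>A. \<forall>p\<in>cdom c \<inter> cdom d. \<forall>L. transition_derivative c d p L \<longrightarrow> X d p = L (X c p))"

definition bilinear_field_on ::
  "('a, 'c::real_normed_vector) chart set \<Rightarrow> ('a, 'c) bilinear_field \<Rightarrow> bool" where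
  "bilinear_field_on A g \<longleftrightarrow>
     (\<forall>c\<in>A. \<forall>p\<in>cdom c. bilinear (g c p)) \<and>
     (\<forall>c\<in>A. \<forall>d\<in>A. \<forall>p\<in>cdom c \<inter> cdom d. \<forall>L. transition_derivative c d p L \<longrightarrow>
        (\<forall>u v. g d p (L u) (L v) = g c p u v))"

text \<open>Signature \<open>(-, +, \<dots>, +)\<close>: there is an orthonormal basis with one timelike vector.\<close>

definition lorentzian_form :: "('c::euclidean_space \<Rightarrow> 'c \<Rightarrow> real) \<Rightarrow> bool" where
  "lorentzian_form h \<longleftrightarrow> bilinear h \<and> (\<forall>u v. h u v = h v u) \<and>
     (\<exists>B e0. e0 \<in> B \<and> independent B \<and> span B = UNIV \<and>
        (\<forall>b\<in>B. \<forall>b'\<in>B. h b b' = (if b \<noteq> b' then 0 else if b = e0 then -1 else 1)))"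

definition lorentzian_metric ::
  "('a, 'c::euclidean_space) chart set \<Rightarrow> ('a, 'c) bilinear_field \<Rightarrow> bool" where
  "lorentzian_metric A g \<longleftrightarrow> bilinear_field_on A g \<and>
     (\<forall>c\<in>A. \<forall>p\<in>cdom c. lorentzian_form (g c p)) \<and>
     (\<forall>c\<in>A. \<forall>u v. smooth_on (cimage c) (\<lambda>x. g c (cinv c x) u v))"

text \<open>
  A time orientation is given by a continuous timelike vector field, which is declared to be
  future-directed.
\<close>

definition time_orientation ::
  "('a::topological_space, 'c::euclidean_space) chart set \<Rightarrow> ('a, 'c) bilinear_field \<Rightarrow>
   ('a, 'c) vector_field \<Rightarrow> bool" where
  "time_orientation A g T \<longleftrightarrow> vector_field_on A T \<and>
     (\<forall>c\<in>A. continuous_on (cdom c) (T c) \<and> (\<forall>p\<in>cdom c. g c p (T c p) (T c p) < 0))"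

definition spacetime ::
  "('a::{t2_space, second_countable_topology}, 'e::euclidean_space \<times> real) chart set \<Rightarrow>
   ('a, 'e \<times> real) bilinear_field \<Rightarrow> ('a, 'e \<times> real) vector_field \<Rightarrow> bool" where
  "spacetime A g T \<longleftrightarrow> smooth_manifold A \<and> mboundary A = {} \<and>
     carrier A \<noteq> {} \<and> connected (carrier A) \<and> lorentzian_metric A g \<and> time_orientation A g T"


section \<open>Causality\<close>

definition future_causal ::
  "('a, 'c::real_vector) bilinear_field \<Rightarrow> ('a, 'c) vector_field \<Rightarrow> ('a, 'c) chart \<Rightarrow>
   'a \<Rightarrow> 'c \<Rightarrow> bool" where
  "future_causal g T c p v \<longleftrightarrow> v \<noteq> 0 \<and> g c p v v \<le> 0 \<and> g c p (T c p) v < 0"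

definition future_timelike ::
  "('a, 'c::real_vector) bilinear_field \<Rightarrow> ('a, 'c) vector_field \<Rightarrow> ('a, 'c) chart \<Rightarrow>
   'a \<Rightarrow> 'c \<Rightarrow> bool" where
  "future_timelike g T c p v \<longleftrightarrow> g c p v v < 0 \<and> g c p (T c p) v < 0"

text \<open>
  \<open>C1_piece A P \<gamma> s t\<close>: the curve \<open>\<gamma>\<close> is continuously differentiable on \<open>[s, t]\<close> (one-sided at the
  end points) and all its velocity vectors satisfy \<open>P\<close>.
\<close>

definition C1_piece ::
  "('a, 'c::real_normed_vector) chart set \<Rightarrow> (('a, 'c) chart \<Rightarrow> 'a \<Rightarrow> 'c \<Rightarrow> bool) \<Rightarrow>
   (real \<Rightarrow> 'a) \<Rightarrow> real \<Rightarrow> real \<Rightarrow> bool" where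
  "C1_piece A P \<gamma> s t \<longleftrightarrow> (\<forall>c\<in>A. \<exists>v.
     continuous_on {\<tau>\<in>{s..t}. \<gamma> \<tau> \<in> cdom c} v \<and>
     (\<forall>\<tau>\<in>{s..t}. \<gamma> \<tau> \<in> cdom c \<longrightarrow>
        ((\<lambda>\<sigma>. cmap c (\<gamma> \<sigma>)) has_vector_derivative v \<tau>) (at \<tau> within {s..t}) \<and>
        P c (\<gamma> \<tau>) (v \<tau>)))"

text \<open>
  Piecewise \<open>C\<^sup>1\<close> curves \<open>[a, b] \<rightarrow> S\<close> with velocities in \<open>P\<close>; \<open>F\<close> is the set of break points.
\<close>

definition curve_in ::
  "('a::topological_space, 'c::real_normed_vector) chart set \<Rightarrow>
   (('a, 'c) chart \<Rightarrow> 'a \<Rightarrow> 'c \<Rightarrow> bool) \<Rightarrow> 'a set \<Rightarrow> (real \<Rightarrow> 'a) \<Rightarrow> real \<Rightarrow> real \<Rightarrow> bool" where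
  "curve_in A P S \<gamma> a b \<longleftrightarrow> a < b \<and> continuous_on {a..b} \<gamma> \<and> \<gamma> ` {a..b} \<subseteq> S \<and>
     (\<exists>F. finite F \<and>
        (\<forall>s t. a \<le> s \<and> s < t \<and> t \<le> b \<and> {s<..<t} \<inter> F = {} \<longrightarrow> C1_piece A P \<gamma> s t))"

definition causal_future ::
  "('a::topological_space, 'c::real_normed_vector) chart set \<Rightarrow> ('a, 'c) bilinear_field \<Rightarrow>
   ('a, 'c) vector_field \<Rightarrow> 'a set \<Rightarrow> 'a set \<Rightarrow> 'a set" where
  "causal_future A g T K S =
     K \<union> {q. \<exists>\<gamma> a b. curve_in A (future_causal g T) S \<gamma> a b \<and> \<gamma> a \<in> K \<and> \<gamma> b = q}"

definition causal_past ::
  "('a::topological_space, 'c::real_normed_vector) chart set \<Rightarrow> ('a, 'c) bilinear_field \<Rightarrow>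
   ('a, 'c) vector_field \<Rightarrow> 'a set \<Rightarrow> 'a set \<Rightarrow> 'a set" where
  "causal_past A g T K S =
     K \<union> {p. \<exists>\<gamma> a b. curve_in A (future_causal g T) S \<gamma> a b \<and> \<gamma> a = p \<and> \<gamma> b \<in> K}"

definition timelike_past ::
  "('a::topological_space, 'c::real_normed_vector) chart set \<Rightarrow> ('a, 'c) bilinear_field \<Rightarrow>
   ('a, 'c) vector_field \<Rightarrow> 'a set \<Rightarrow> 'a set \<Rightarrow> 'a set" where
  "timelike_past A g T K S =
     {p. \<exists>\<gamma> a b. curve_in A (future_timelike g T) S \<gamma> a b \<and> \<gamma> a = p \<and> \<gamma> b \<in> K}"

definition strongly_causal ::
  "('a::topological_space, 'c::real_normed_vector) chart set \<Rightarrow> ('a, 'c) bilinear_field \<Rightarrow>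
   ('a, 'c) vector_field \<Rightarrow> 'a set \<Rightarrow> bool" where
  "strongly_causal A g T S \<longleftrightarrow>
     (\<forall>p\<in>S. \<forall>U. open U \<and> p \<in> U \<longrightarrow>
        (\<exists>V. open V \<and> p \<in> V \<and> V \<subseteq> U \<and>
           (\<forall>\<gamma> a b. curve_in A (future_causal g T) S \<gamma> a b \<and> \<gamma> a \<in> V \<and> \<gamma> b \<in> V \<longrightarrow>
              \<gamma> ` {a..b} \<subseteq> U)))"

definition globally_hyperbolic ::
  "('a::topological_space, 'c::real_normed_vector) chart set \<Rightarrow> ('a, 'c) bilinear_field \<Rightarrow>
   ('a, 'c) vector_field \<Rightarrow> 'a set \<Rightarrow> bool" where
  "globally_hyperbolic A g T S \<longleftrightarrow> strongly_causal A g T S \<and>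
     (\<forall>p\<in>S. \<forall>q\<in>S. compact (causal_future A g T {p} S \<inter> causal_past A g T {q} S))"


section \<open>Ricci curvature\<close>

text \<open>
  All of this takes place in the coordinates of a chart, on a manifold without boundary. For
  constant coordinate fields \<open>u\<close>, \<open>v\<close>, the vector \<open>christoffel g c x u v\<close> is the covariant
  derivative of \<open>v\<close> along \<open>u\<close>, given by the Koszul formula.
\<close>

definition metric_coord ::
  "('a, 'c) bilinear_field \<Rightarrow> ('a, 'c) chart \<Rightarrow> 'c \<Rightarrow> 'c \<Rightarrow> 'c \<Rightarrow> real" where
  "metric_coord g c x u v = g c (cinv c x) u v"

definition dir_deriv ::
  "'c::real_normed_vector \<Rightarrow> ('c \<Rightarrow> 'd::real_normed_vector) \<Rightarrow> 'c \<Rightarrow> 'd" where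
  "dir_deriv u f x = frechet_derivative f (at x) u"

definition christoffel ::
  "('a, 'c::euclidean_space) bilinear_field \<Rightarrow> ('a, 'c) chart \<Rightarrow> 'c \<Rightarrow> 'c \<Rightarrow> 'c \<Rightarrow> 'c" where
  "christoffel g c x u v = (THE z. \<forall>w. metric_coord g c x z w =
     (dir_deriv u (\<lambda>y. metric_coord g c y v w) x
      + dir_deriv v (\<lambda>y. metric_coord g c y u w) x
      - dir_deriv w (\<lambda>y. metric_coord g c y u v) x) / 2)"

text \<open>\<open>R(u,v)w = \<nabla>\<^sub>u \<nabla>\<^sub>v w - \<nabla>\<^sub>v \<nabla>\<^sub>u w\<close> for constant coordinate fields.\<close>

definition riemann ::
  "('a, 'c::euclidean_space) bilinear_field \<Rightarrow> ('a, 'c) chart \<Rightarrow> 'c \<Rightarrow> 'c \<Rightarrow> 'c \<Rightarrow> 'c \<Rightarrow> 'c" where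
  "riemann g c x u v w =
     dir_deriv u (\<lambda>y. christoffel g c y v w) x + christoffel g c x u (christoffel g c x v w)
     - dir_deriv v (\<lambda>y. christoffel g c y u w) x - christoffel g c x v (christoffel g c x u w)"

text \<open>\<open>Ric(v,w)\<close> is the trace of \<open>u \<mapsto> R(u,v)w\<close>.\<close>

definition ricci :: "('a, 'c::euclidean_space) bilinear_field \<Rightarrow> ('a, 'c) bilinear_field" where
  "ricci g c p v w = (\<Sum>b\<in>Basis. riemann g c (cmap c p) b v w \<bullet> b)"

definition null_energy_condition ::
  "('a, 'c::euclidean_space) chart set \<Rightarrow> ('a, 'c) bilinear_field \<Rightarrow> 'a set \<Rightarrow> bool" where
  "null_energy_condition A g D \<longleftrightarrow>
     (\<forall>c\<in>A. \<forall>p\<in>cdom c \<inter> D. \<forall>X. g c p X X = 0 \<longrightarrow> ricci g c p X X \<ge> 0)"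


section \<open>Conformal completions\<close>

text \<open>
  The physical manifold \<open>AM\<close> is the interior of the completion \<open>A\<close>. Its charts are charts of \<open>A\<close>,
  so one field \<open>T\<close> serves for both: the time orientation of the completion restricts to that of
  the spacetime.
\<close>

definition conformal_completion ::
  "('a::{t2_space, second_countable_topology}, 'e::euclidean_space \<times> real) chart set \<Rightarrow>
   ('a, 'e \<times> real) bilinear_field \<Rightarrow> ('a, 'e \<times> real) vector_field \<Rightarrow>
   ('a, 'e \<times> real) chart set \<Rightarrow> ('a, 'e \<times> real) bilinear_field \<Rightarrow> ('a \<Rightarrow> real) \<Rightarrow> bool" where
  "conformal_completion AM g T A gt \<Omega> \<longleftrightarrow>
     smooth_manifold A \<and> AM = open_submanifold A (minterior A) \<and>
     lorentzian_metric A gt \<and> time_orientation A gt T \<and>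
     (\<forall>c\<in>AM. \<forall>p\<in>cdom c. \<forall>u v. gt c p u v = (\<Omega> p)\<^sup>2 * g c p u v) \<and>
     (\<forall>p\<in>minterior A. \<Omega> p > 0) \<and> (\<forall>p\<in>mboundary A. \<Omega> p = 0) \<and>
     (\<forall>c\<in>A. \<forall>p\<in>cdom c. \<exists>d\<Omega>.
        ((\<lambda>x. \<Omega> (cinv c x)) has_derivative d\<Omega>) (at (cmap c p) within cimage c) \<and>
        (p \<in> mboundary A \<longrightarrow> d\<Omega> \<noteq> (\<lambda>_. 0)))"

definition scri_plus ::
  "('a::topological_space, 'e::euclidean_space \<times> real) chart set \<Rightarrow>
   ('a, 'e \<times> real) bilinear_field \<Rightarrow> ('a, 'e \<times> real) vector_field \<Rightarrow> 'a set" where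
  "scri_plus A gt T = mboundary A \<inter> causal_future A gt T (minterior A) (carrier A)"

definition future_conformal_completion ::
  "('a::{t2_space, second_countable_topology}, 'e::euclidean_space \<times> real) chart set \<Rightarrow>
   ('a, 'e \<times> real) bilinear_field \<Rightarrow> ('a, 'e \<times> real) vector_field \<Rightarrow>
   ('a, 'e \<times> real) chart set \<Rightarrow> ('a, 'e \<times> real) bilinear_field \<Rightarrow> ('a \<Rightarrow> real) \<Rightarrow> bool" where
  "future_conformal_completion AM g T A gt \<Omega> \<longleftrightarrow> conformal_completion AM g T A gt \<Omega> \<and>
     carrier A = carrier AM \<union> scri_plus A gt T"

text \<open>The domain \<open>I\<^sup>-(\<I>\<^sup>+) \<inter> M\<close>.\<close>

definition scri_domain ::
  "('a::topological_space, 'e::euclidean_space \<times> real) chart set \<Rightarrow>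
   ('a, 'e \<times> real) bilinear_field \<Rightarrow> ('a, 'e \<times> real) vector_field \<Rightarrow> 'a set" where
  "scri_domain A gt T = timelike_past A gt T (scri_plus A gt T) (carrier A) \<inter> minterior A"

text \<open>
  A hypersurface \<open>N\<close> is locally a level set of the last coordinate of a chart (the level 0 for
  pieces of the boundary), so its tangent vectors are those with vanishing last component. It is
  null if the induced metric is degenerate at every point.
\<close>

definition null_hypersurface ::
  "('a, 'e::euclidean_space \<times> real) chart set \<Rightarrow> ('a, 'e \<times> real) bilinear_field \<Rightarrow> 'a set \<Rightarrow> bool"
where
  "null_hypersurface A gt N \<longleftrightarrow>
     (\<forall>p\<in>N. \<exists>c\<in>A. p \<in> cdom c \<and> N \<inter> cdom c = {q \<in> cdom c. snd (cmap c q) = snd (cmap c p)} \<and>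
        (\<exists>v. v \<noteq> 0 \<and> snd v = 0 \<and> (\<forall>w. snd w = 0 \<longrightarrow> gt c p v w = 0)))"

end

theory Submission
  imports Defs
begin

text \<open>
  Suppose that all of \<open>\<I>\<^sup>+\<close> lies in the causal future of the compact set \<open>K\<close>. Covering \<open>K\<close> by
  chronological futures of finitely many points \<open>x\<^sub>i\<close> of \<open>\<D>\<close>, one sees that for \<open>p \<in> \<I>\<^sup>+\<close> the set
  \<open>\<I>\<^sup>+ \<inter> J\<^sup>-(p)\<close> is contained in the union of the sets \<open>J\<^sup>+(x\<^sub>i) \<inter> J\<^sup>-(p)\<close>, which is compact by
  global hyperbolicity. The null generator of \<open>\<I>\<^sup>+\<close> through \<open>p\<close>, followed to the past, therefore stays
  in a compact set. Since it leaves a neighbourhood of every point of \<open>\<I>\<^sup>+\<close> that it meets, it has to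
  return to one of finitely many such neighbourhoods, against strong causality. The generators are the
  integral curves of the gradient of a defining function of \<open>\<I>\<^sup>+\<close>.
\<close>

section \<open>Calculus and ordinary differential equations\<close>

text \<open>Generators are followed to the past because this never leaves the causal past of
  \<open>p\<close>; to the future no such bound is at hand. No inextendible generator and no limit
  curve is constructed: short segments, each leaving a neighbourhood, are iterated to a sequence of
  points, and compactness turns this into a pigeonhole argument. The obstacle is the boundary, where
  charts take values in a half-space and curves cannot move in every direction. The generator
  equation is therefore solved inside one level of the last coordinate, where the unknown ranges
  over the full space \<open>'e\<close>. The cover of \<open>K\<close>, in contrast, uses straight
  lines in all directions near \<open>T\<close>, and gets by with interior charts. The gradient is
  tangent to the hypersurface because it spans the normal direction, which at a null hypersurface is
  itself tangent. The compact set is cut down to the boundary by removing the open interior, so that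
  generators are available at each of its points.\<close>

lemma Ck_on_Suc_0_has_derivative:
  assumes "Ck_on (Suc 0) W f" "x \<in> W"
  shows "(f has_derivative frechet_derivative f (at x)) (at x)"
  using assms by (simp add: frechet_derivative_works)

lemma frechet_derivative_sum_Basis:
  fixes f :: "'c::euclidean_space \<Rightarrow> 'd::real_normed_vector"
  assumes "Ck_on (Suc 0) W f" "x \<in> W"
  shows "frechet_derivative f (at x) v = (\<Sum>b\<in>Basis. (v \<bullet> b) *\<^sub>R frechet_derivative f (at x) b)"
proof -
  have "linear (frechet_derivative f (at x))"
    using Ck_on_Suc_0_has_derivative[OF assms] has_derivative_linear by blast
  then show ?thesis
    by (subst euclidean_representation[of v, symmetric]) (simp add: linear_sum linear_cmul)
qed

text \<open>\<open>Ck_on\<close> controls the derivative only in one fixed direction at a time.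
  Expanding the direction in the finite basis yields continuity jointly in base point and
  direction.\<close>

lemma continuous_on_frechet_derivative_Ck:
  fixes f :: "'c::euclidean_space \<Rightarrow> 'd::real_normed_vector"
  assumes f: "Ck_on (Suc 0) W f" and x: "continuous_on S x" "x ` S \<subseteq> W" and v: "continuous_on S v"
  shows "continuous_on S (\<lambda>t. frechet_derivative f (at (x t)) (v t))"
proof -
  have "continuous_on S (\<lambda>t. \<Sum>b\<in>Basis. (v t \<bullet> b) *\<^sub>R frechet_derivative f (at (x t)) b)"
  proof (intro continuous_intros v)
    fix b
    have "continuous_on W (\<lambda>y. frechet_derivative f (at y) b)" using f by simp
    then show "continuous_on S (\<lambda>t. frechet_derivative f (at (x t)) b)"
      by (rule continuous_on_compose2[OF _ x])
  qed
  moreover have "(\<Sum>b\<in>Basis. (v t \<bullet> b) *\<^sub>R frechet_derivative f (at (x t)) b)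
      = frechet_derivative f (at (x t)) (v t)" if "t \<in> S" for t
    using frechet_derivative_sum_Basis[OF f, of "x t" "v t"] x that by auto
  ultimately show ?thesis using continuous_on_cong by force
qed

text \<open>\<open>S\<close> may be neither open nor convex, so the mean value inequality is applied
  to a local smooth extension on a ball and then restricted to \<open>S\<close>.\<close>

lemma smooth_on_locally_lipschitz:
  fixes f :: "'c::euclidean_space \<Rightarrow> 'd::real_normed_vector"
  assumes "smooth_on S f" "x \<in> S"
  obtains r L where "0 < r" "L-lipschitz_on (cball x r \<inter> S) f"
proof -
  obtain W F where W: "open W" "x \<in> W" "\<And>k. Ck_on k W F" "\<And>y. y \<in> W \<inter> S \<Longrightarrow> F y = f y"
    using assms(1)[unfolded smooth_on_def, rule_format, OF assms(2)] by auto
  obtain r where r: "0 < r" "cball x r \<subseteq> W" using W(1,2) open_contains_cball by metis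
  have F: "Ck_on (Suc 0) W F" by (rule W(3))
  \<comment> \<open>Dominates the operator norm of the derivative, and is continuous because only
    finitely many fixed directions enter.\<close>
  let ?n = "\<lambda>y. \<Sum>b\<in>Basis. norm (frechet_derivative F (at y) b)"
  have "continuous_on (cball x r) ?n"
  proof (intro continuous_on_sum continuous_on_norm)
    fix b
    have "continuous_on W (\<lambda>y. frechet_derivative F (at y) b)" using F by simp
    then show "continuous_on (cball x r) (\<lambda>y. frechet_derivative F (at y) b)"
      using r(2) by (rule continuous_on_subset)
  qed
  then have "bounded (?n ` cball x r)"
    by (intro compact_imp_bounded compact_continuous_image) auto
  then obtain L where L': "0 < L" "\<And>z. z \<in> ?n ` cball x r \<Longrightarrow> norm z \<le> L"
    unfolding bounded_pos by blast
  have L: "?n y \<le> L" if "y \<in> cball x r" for y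
    using L'(2)[of "?n y"] that by force
  have bd: "norm (F y - F z) \<le> L * norm (y - z)" if "y \<in> cball x r" "z \<in> cball x r" for y z
  proof (rule differentiable_bound[where S = "cball x r" and f' = "\<lambda>y. frechet_derivative F (at y)"])
    fix w assume w: "w \<in> cball x r"
    then have w': "w \<in> W" using r(2) by auto
    show "(F has_derivative frechet_derivative F (at w)) (at w within cball x r)"
      using Ck_on_Suc_0_has_derivative[OF F w'] has_derivative_at_withinI by blast
    show "onorm (frechet_derivative F (at w)) \<le> L"
    proof (rule onorm_le)
      fix v
      have "norm (frechet_derivative F (at w) v) \<le> (\<Sum>b\<in>Basis. norm ((v \<bullet> b) *\<^sub>R frechet_derivative F (at w) b))"
        by (subst frechet_derivative_sum_Basis[OF F w', of v]) (rule norm_sum)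
      also have "\<dots> \<le> (\<Sum>b\<in>Basis. norm (frechet_derivative F (at w) b) * norm v)"
        by (intro sum_mono) (use Basis_le_norm in \<open>auto simp: mult.commute intro!: mult_right_mono\<close>)
      also have "\<dots> = ?n w * norm v" by (simp add: sum_distrib_right)
      also have "\<dots> \<le> L * norm v" using L[OF w] by (intro mult_right_mono) auto
      finally show "norm (frechet_derivative F (at w) v) \<le> L * norm v" .
    qed
  qed (use that in auto)
  have "L-lipschitz_on (cball x r \<inter> S) f"
  proof (intro lipschitz_onI)
    fix y z assume yz: "y \<in> cball x r \<inter> S" "z \<in> cball x r \<inter> S"
    then have "F y = f y" "F z = f z" using W(4)[of y] W(4)[of z] r(2) by auto
    then show "dist (f y) (f z) \<le> L * dist y z"
      using bd[of y z] yz by (simp add: dist_norm)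
  qed (use L'(1) in auto)
  then show thesis using r(1) that by blast
qed

lemma smooth_on_imp_continuous_on:
  fixes f :: "'c::euclidean_space \<Rightarrow> 'd::real_normed_vector"
  assumes "smooth_on S f"
  shows "continuous_on S f"
  unfolding continuous_on_eq_continuous_within
proof
  fix x assume x: "x \<in> S"
  then obtain r L where r: "0 < r" and L: "L-lipschitz_on (cball x r \<inter> S) f"
    using assms smooth_on_locally_lipschitz by blast
  have "continuous (at x within cball x r \<inter> S) f"
    using lipschitz_on_continuous_on[OF L] x r by (simp add: continuous_on_eq_continuous_within)
  moreover have "at x within cball x r \<inter> S = at x within S"
    by (rule at_within_nhd[where S = "ball x r"]) (use r in auto)
  ultimately show "continuous (at x within S) f" by simp
qed

text \<open>Picard iteration: the integral operator is a contraction with factor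
  \<open>h * L\<close>. A right-hand side that is Lipschitz on the whole space spares any control of
  where the iterates go.\<close>

lemma picard_lipschitz:
  fixes f :: "'d::euclidean_space \<Rightarrow> 'd"
  assumes f: "L-lipschitz_on UNIV f" and "0 < h" "h * L < 1"
  obtains y where "y 0 = y0" "\<And>t. t \<in> {0..h} \<Longrightarrow> (y has_vector_derivative f (y t)) (at t within {0..h})"
proof -
  \<comment> \<open>Clamping time to the interval turns functions on \<open>{0..h}\<close> into
    bounded continuous functions on the line, whose space is complete.\<close>
  define cl where "cl t = max 0 (min h t)" for t :: real
  have cl: "cl t \<in> {0..h}" for t using \<open>0 < h\<close> by (auto simp: cl_def)
  have cl_id: "cl t = t" if "t \<in> {0..h}" for t using that by (auto simp: cl_def)
  have cont_cl: "continuous_on UNIV cl" unfolding cl_def by (intro continuous_intros)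
  have cont_f: "continuous_on UNIV f" using f lipschitz_on_continuous_on by blast
  have cont_fu: "continuous_on S (\<lambda>s. f (apply_bcontfun u s))" for S :: "real set" and u
    by (rule continuous_on_compose2[OF cont_f]) auto
  define I where "I u t = y0 + integral {0..t} (\<lambda>s. f (apply_bcontfun u s))" for u :: "real \<Rightarrow>\<^sub>C 'd" and t :: real
  have I_deriv: "(I u has_vector_derivative f (apply_bcontfun u t)) (at t within {0..h})"
    if "t \<in> {0..h}" for u t
    unfolding I_def
    by (rule has_vector_derivative_eq_rhs,
        rule has_vector_derivative_add[OF has_vector_derivative_const
          integral_has_vector_derivative[OF cont_fu that]]) simp
  have cont_I: "continuous_on {0..h} (I u)" for u
    unfolding continuous_on_eq_continuous_within
    using I_deriv[THEN has_vector_derivative_continuous] by blast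
  have bc: "(\<lambda>t. I u (cl t)) \<in> bcontfun" for u
  proof -
    have "bounded (I u ` {0..h})"
      by (intro compact_imp_bounded compact_continuous_image cont_I) auto
    then have "bounded (range (\<lambda>t. I u (cl t)))"
      by (rule bounded_subset) (use cl in auto)
    moreover have "continuous_on UNIV (\<lambda>t. I u (cl t))"
      by (rule continuous_on_compose2[OF cont_I cont_cl]) (use cl in auto)
    ultimately show ?thesis by (simp add: bcontfun_def)
  qed
  define \<Phi> where "\<Phi> u = Bcontfun (\<lambda>t. I u (cl t))" for u
  have app: "apply_bcontfun (\<Phi> u) t = I u (cl t)" for u t
    unfolding \<Phi>_def using Bcontfun_inverse[OF bc] by metis
  have L0: "0 \<le> L" using f lipschitz_on_nonneg by blast
  have "dist (\<Phi> u) (\<Phi> v) \<le> (h * L) * dist u v" for u v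
  proof (rule dist_bound)
    fix t
    let ?d = "\<lambda>s. f (apply_bcontfun u s) - f (apply_bcontfun v s)"
    have "dist (apply_bcontfun (\<Phi> u) t) (apply_bcontfun (\<Phi> v) t)
        = norm (integral {0..cl t} ?d)"
      unfolding app I_def dist_norm
      by (simp add: integral_diff integrable_continuous_real cont_fu)
    also have "\<dots> \<le> (L * dist u v) * (cl t - 0)"
    proof (rule integral_bound)
      fix s
      have "norm (?d s) \<le> L * dist (apply_bcontfun u s) (apply_bcontfun v s)"
        using f unfolding lipschitz_on_def dist_norm by blast
      also have "\<dots> \<le> L * dist u v" by (intro mult_left_mono dist_bounded L0)
      finally show "norm (?d s) \<le> L * dist u v" .
    qed (use cl[of t] in \<open>auto intro: continuous_on_diff cont_fu\<close>)
    also have "\<dots> \<le> (L * dist u v) * h"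
      using cl[of t] L0 by (intro mult_left_mono) auto
    finally show "dist (apply_bcontfun (\<Phi> u) t) (apply_bcontfun (\<Phi> v) t) \<le> (h * L) * dist u v"
      by (simp add: mult_ac)
  qed
  then have "\<exists>!u. \<Phi> u = u"
    using assms L0 by (intro banach_fix_type[of "h * L"]) auto
  then obtain u where u: "\<Phi> u = u" by blast
  have u_I: "apply_bcontfun u t = I u t" if "t \<in> {0..h}" for t
    using app[of u t] u cl_id[OF that] by simp
  have "apply_bcontfun u 0 = y0" using u_I[of 0] \<open>0 < h\<close> by (simp add: I_def)
  moreover have "(apply_bcontfun u has_vector_derivative f (apply_bcontfun u t)) (at t within {0..h})"
    if "t \<in> {0..h}" for t
    by (rule has_vector_derivative_transform[OF that u_I I_deriv[OF that]])
  ultimately show thesis using that by blast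
qed

section \<open>Lorentzian forms and causal curves in charts\<close>

lemma bilinear_sum_scaleR_left:
  fixes h :: "'c::real_vector \<Rightarrow> 'd::real_vector \<Rightarrow> real"
  assumes "bilinear h"
  shows "h (\<Sum>i\<in>I. f i *\<^sub>R x i) w = (\<Sum>i\<in>I. f i * h (x i) w)"
proof -
  have "linear (\<lambda>x. h x w)" using assms by (simp add: bilinear_def)
  from linear_sum[OF this, of "\<lambda>i. f i *\<^sub>R x i" I] linear_cmul[OF this] show ?thesis by simp
qed

lemma bilinear_sum_scaleR_right:
  fixes h :: "'c::real_vector \<Rightarrow> 'd::real_vector \<Rightarrow> real"
  assumes "bilinear h"
  shows "h w (\<Sum>i\<in>I. f i *\<^sub>R x i) = (\<Sum>i\<in>I. f i * h w (x i))"
proof -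
  have "linear (\<lambda>x. h w x)" using assms by (simp add: bilinear_def)
  from linear_sum[OF this, of "\<lambda>i. f i *\<^sub>R x i" I] linear_cmul[OF this] show ?thesis by simp
qed

lemma bilinear_expand_Basis:
  fixes h :: "'c::euclidean_space \<Rightarrow> 'c \<Rightarrow> real"
  assumes "bilinear h"
  shows "h u w = (\<Sum>i\<in>Basis. \<Sum>j\<in>Basis. (u \<bullet> i) * (w \<bullet> j) * h i j)"
proof -
  have "h u w = (\<Sum>i\<in>Basis. (u \<bullet> i) * h i w)"
    using bilinear_sum_scaleR_left[OF assms, of "\<lambda>i. u \<bullet> i" "\<lambda>i. i" Basis w]
    by (simp add: euclidean_representation)
  also have "\<dots> = (\<Sum>i\<in>Basis. \<Sum>j\<in>Basis. (u \<bullet> i) * (w \<bullet> j) * h i j)"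
    using bilinear_sum_scaleR_right[OF assms, of _ "\<lambda>i. w \<bullet> i" "\<lambda>i. i" Basis]
    by (simp add: euclidean_representation sum_distrib_left mult.assoc)
  finally show ?thesis .
qed

lemma lorentzian_form_nondegenerate:
  fixes h :: "'c::euclidean_space \<Rightarrow> 'c \<Rightarrow> real"
  assumes "lorentzian_form h" and zero: "\<And>w. h u w = 0"
  shows "u = 0"
proof -
  obtain B e0 where B: "independent B" "span B = UNIV"
    and h: "\<And>b b'. b \<in> B \<Longrightarrow> b' \<in> B \<Longrightarrow> h b b' = (if b \<noteq> b' then 0 else if b = e0 then -1 else 1)"
    and bil: "bilinear h"
    using assms(1) unfolding lorentzian_form_def by blast
  have fin: "finite B" using B(1) independent_bound by blast
  define f where "f = representation B u"
  have u: "u = (\<Sum>b\<in>B. f b *\<^sub>R b)"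
    unfolding f_def using B fin by (simp add: sum_representation_eq)
  have "f b = 0" if "b \<in> B" for b
  proof -
    have "h u b = (\<Sum>b'\<in>B. f b' * h b' b)"
      by (subst u) (rule bilinear_sum_scaleR_left[OF bil])
    also have "\<dots> = (\<Sum>b'\<in>B. if b' = b then f b * (if b = e0 then -1 else 1) else 0)"
      using h that by (intro sum.cong) auto
    also have "\<dots> = f b * (if b = e0 then -1 else 1)" using fin that by simp
    finally show ?thesis using zero[of b] by (auto split: if_splits)
  qed
  then show ?thesis using u by simp
qed

text \<open>In an orthonormal basis this is the Cauchy-Schwarz inequality for the spatial components.\<close>

lemma lorentzian_form_timelike_causal:
  fixes h :: "'c::euclidean_space \<Rightarrow> 'c \<Rightarrow> real"
  assumes "lorentzian_form h" "h u u < 0" "h v v \<le> 0" "v \<noteq> 0"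
  shows "h u v \<noteq> 0"
proof
  assume huv: "h u v = 0"
  obtain B e0 where B: "independent B" "span B = UNIV" "e0 \<in> B"
    and h: "\<And>b b'. b \<in> B \<Longrightarrow> b' \<in> B \<Longrightarrow> h b b' = (if b \<noteq> b' then 0 else if b = e0 then -1 else 1)"
    and bil: "bilinear h"
    using assms(1) unfolding lorentzian_form_def by blast
  have fin: "finite B" using B(1) independent_bound by blast
  define f where "f = representation B"
  have rep: "x = (\<Sum>b\<in>B. f x b *\<^sub>R b)" for x
    unfolding f_def using B fin by (simp add: sum_representation_eq)
  let ?S = "B - {e0}"
  have h_eq: "h x y = (\<Sum>b\<in>?S. f x b * f y b) - f x e0 * f y e0" for x y
  proof -
    have "h x y = (\<Sum>b\<in>B. \<Sum>b'\<in>B. f x b * f y b' * h b b')"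
    proof -
      have "h x y = (\<Sum>b\<in>B. f x b * h b y)"
        by (subst rep[of x]) (rule bilinear_sum_scaleR_left[OF bil])
      moreover have "h b y = (\<Sum>b'\<in>B. f y b' * h b b')" for b
        by (subst rep[of y]) (rule bilinear_sum_scaleR_right[OF bil])
      ultimately show ?thesis by (simp add: sum_distrib_left mult.assoc)
    qed
    also have "\<dots> = (\<Sum>b\<in>B. f x b * f y b * (if b = e0 then -1 else 1))"
    proof (intro sum.cong refl)
      fix b assume b: "b \<in> B"
      have "(\<Sum>b'\<in>B. f x b * f y b' * h b b') = (\<Sum>b'\<in>B. if b' = b then f x b * f y b * (if b = e0 then -1 else 1) else 0)"
        using h b by (intro sum.cong) auto
      then show "(\<Sum>b'\<in>B. f x b * f y b' * h b b') = f x b * f y b * (if b = e0 then -1 else 1)"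
        using fin b by simp
    qed
    also have "\<dots> = (\<Sum>b\<in>?S. f x b * f y b) - f x e0 * f y e0"
      by (subst sum.remove[OF fin B(3)]) (auto intro: sum.cong)
    finally show ?thesis .
  qed
  let ?a = "f u e0" and ?c = "f v e0"
  let ?U = "\<Sum>b\<in>?S. (f u b)\<^sup>2" and ?V = "\<Sum>b\<in>?S. (f v b)\<^sup>2"
  have U: "?U < ?a\<^sup>2" using assms(2) by (simp add: h_eq power2_eq_square)
  have V: "?V \<le> ?c\<^sup>2" using assms(3) by (simp add: h_eq power2_eq_square)
  \<comment> \<open>A causal vector without time component has no spatial one either. This
    nonvanishing makes the last inequality below strict.\<close>
  have "?c \<noteq> 0"
  proof
    assume c: "?c = 0"
    then have "?V = 0" using V by (simp add: antisym sum_nonneg)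
    then have "\<forall>b\<in>?S. f v b = 0" using fin by (simp add: sum_nonneg_eq_0_iff)
    then have "v = 0" using c by (subst rep[of v]) (auto intro!: sum.neutral)
    then show False using assms(4) by simp
  qed
  have "(?a * ?c)\<^sup>2 = (\<Sum>b\<in>?S. f u b * f v b)\<^sup>2" using huv by (simp add: h_eq)
  also have "\<dots> \<le> ?U * ?V" by (rule Cauchy_Schwarz_ineq_sum)
  also have "\<dots> \<le> ?U * ?c\<^sup>2" using V by (intro mult_left_mono sum_nonneg) auto
  also have "\<dots> < ?a\<^sup>2 * ?c\<^sup>2" using U \<open>?c \<noteq> 0\<close> by (intro mult_strict_right_mono) auto
  finally show False by (simp add: power_mult_distrib)
qed

text \<open>A velocity condition with this property needs to be verified in one chart only.
  \<open>P\<close> is left abstract to serve causal and timelike curves alike.\<close>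

definition transition_invariant ::
  "('a, 'c::real_normed_vector) chart set \<Rightarrow> (('a, 'c) chart \<Rightarrow> 'a \<Rightarrow> 'c \<Rightarrow> bool) \<Rightarrow> bool" where
  "transition_invariant A P \<longleftrightarrow> (\<forall>c\<in>A. \<forall>d\<in>A. \<forall>p\<in>cdom c \<inter> cdom d. \<forall>L v.
     transition_derivative c d p L \<and> P c p v \<longrightarrow> P d p (L v))"

lemma transition_invariant_future_timelike:
  assumes "bilinear_field_on A g" "vector_field_on A T"
  shows "transition_invariant A (future_timelike g T)"
  using assms unfolding transition_invariant_def bilinear_field_on_def vector_field_on_def
    future_timelike_def by metis

lemma transition_invariant_future_causal:
  assumes g: "bilinear_field_on A g" and T: "vector_field_on A T"
  shows "transition_invariant A (future_causal g T)"
  unfolding transition_invariant_def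
proof (intro ballI allI impI, elim conjE)
  fix c d p L v
  assume cd: "c \<in> A" "d \<in> A" "p \<in> cdom c \<inter> cdom d" and L: "transition_derivative c d p L"
    and v: "future_causal g T c p v"
  have eq: "g d p (L u) (L w) = g c p u w" for u w
    using g cd L unfolding bilinear_field_on_def by blast
  have T': "T d p = L (T c p)" using T cd L unfolding vector_field_on_def by blast
  have "bilinear (g d p)" using g cd unfolding bilinear_field_on_def by blast
  \<comment> \<open>Read off from the strict inequality for the pairing with \<open>T\<close>, so
    that invertibility of \<open>L\<close> need not be established.\<close>
  then have "L v \<noteq> 0" using eq[of "T c p" v] v by (auto simp: future_causal_def bilinear_rzero)
  then show "future_causal g T d p (L v)" using v by (simp add: future_causal_def eq T')
qed

lemma future_timelike_imp_future_causal:
  assumes "bilinear (g c p)" "future_timelike g T c p v"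
  shows "future_causal g T c p v"
  using assms by (auto simp: future_timelike_def future_causal_def bilinear_rzero)

lemma is_chart_cinv:
  assumes "is_chart c" "x \<in> cimage c"
  shows "cinv c x \<in> cdom c" "cmap c (cinv c x) = x"
  using assms unfolding is_chart_def homeomorphism_def by auto

lemma is_chart_continuous_cinv: "is_chart c \<Longrightarrow> continuous_on (cimage c) (cinv c)"
  by (simp add: is_chart_def homeomorphism_def)

lemma is_chart_cmap:
  assumes "is_chart c" "p \<in> cdom c"
  shows "cmap c p \<in> cimage c" "cinv c (cmap c p) = p"
  using assms unfolding is_chart_def homeomorphism_def by auto

lemma smooth_manifoldD:
  assumes "smooth_manifold A"
  shows "c \<in> A \<Longrightarrow> is_chart c" "c \<in> A \<Longrightarrow> d \<in> A \<Longrightarrow> compatible c d"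
  using assms[unfolded smooth_manifold_def, THEN conjunct1]
    assms[unfolded smooth_manifold_def, THEN conjunct2, THEN conjunct1] by blast+

text \<open>\<open>C1_piece\<close> asks for differentiability in every chart of the maximal atlas;
  the chain rule reduces this to one chart. At the boundary the overlap is not open, so the
  derivative of the transition map is taken from a local smooth extension.\<close>

lemma C1_piece_chart:
  fixes A :: "('a::{t2_space, second_countable_topology}, 'e::euclidean_space \<times> real) chart set"
  assumes A: "smooth_manifold A" and c: "c \<in> A" and P: "transition_invariant A P" and "a < b"
    and x: "x ` {a..b} \<subseteq> cimage c" and v: "continuous_on {a..b} v"
    and deriv: "\<And>t. t \<in> {a..b} \<Longrightarrow> (x has_vector_derivative v t) (at t within {a..b})"
    and Pv: "\<And>t. t \<in> {a..b} \<Longrightarrow> P c (cinv c (x t)) (v t)"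
  shows "C1_piece A P (\<lambda>t. cinv c (x t)) a b"
  unfolding C1_piece_def
proof
  fix d assume d: "d \<in> A"
  have ch: "is_chart c" "is_chart d" using smooth_manifoldD(1)[OF A] c d by blast+
  have contx: "continuous_on {a..b} x"
    using deriv[THEN has_vector_derivative_continuous]
    unfolding continuous_on_eq_continuous_within by blast
  define \<gamma> where "\<gamma> t = cinv c (x t)" for t
  have cm: "cmap c (\<gamma> t) = x t" "\<gamma> t \<in> cdom c" if "t \<in> {a..b}" for t
    using is_chart_cinv[OF ch(1), of "x t"] x that by (simp_all add: \<gamma>_def image_subset_iff)
  have cont\<gamma>: "continuous_on {a..b} \<gamma>"
    unfolding \<gamma>_def by (rule continuous_on_compose2[OF is_chart_continuous_cinv[OF ch(1)] contx x])
  define S where "S = {\<tau>\<in>{a..b}. \<gamma> \<tau> \<in> cdom d}"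
  \<comment> \<open>The extensions below exist only locally. Defining the velocity as the derivative
    within the interval gives one function for all times, and uniqueness of that derivative
    identifies it with each local expression.\<close>
  define w where "w \<tau> = vector_derivative (\<lambda>\<sigma>. cmap d (\<gamma> \<sigma>)) (at \<tau> within {a..b})" for \<tau>
  have overlap: "x t \<in> overlap c d" if "t \<in> S" for t
    unfolding overlap_def using cm[of t] that
    by (intro image_eqI[of _ _ "\<gamma> t"]) (simp_all add: S_def)
  have local: "\<exists>U F W. open U \<and> t \<in> U \<and> Ck_on (Suc 0) W F \<and>
      (\<forall>\<sigma>\<in>U \<inter> {a..b}. \<sigma> \<in> S \<and> x \<sigma> \<in> W \<and>
         ((\<lambda>\<sigma>. cmap d (\<gamma> \<sigma>)) has_vector_derivative frechet_derivative F (at (x \<sigma>)) (v \<sigma>))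
           (at \<sigma> within {a..b}) \<and>
         P d (\<gamma> \<sigma>) (frechet_derivative F (at (x \<sigma>)) (v \<sigma>)))" if "t \<in> S" for t
  proof -
    have tab: "t \<in> {a..b}" using that by (simp add: S_def)
    have "smooth_on (overlap c d) (transition c d)"
      using smooth_manifoldD(2)[OF A c d] by (simp add: compatible_def)
    from this[unfolded smooth_on_def, rule_format, OF overlap[OF that]]
    obtain W F where W: "open W" "x t \<in> W" "\<forall>k. Ck_on k W F"
      "\<forall>y\<in>W \<inter> overlap c d. F y = transition c d y" by (elim exE conjE) (rule that)
    have F: "Ck_on (Suc 0) W F" by (rule W(3)[rule_format])
    obtain U1 where U1: "open U1" "U1 \<inter> {a..b} = x -` W \<inter> {a..b}"
      by (rule exE[OF contx[unfolded continuous_on_open_invariant, rule_format, OF W(1)]]) (elim conjE, rule that)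
    have "open (cdom d)" using ch(2) by (simp add: is_chart_def)
    then obtain U2 where U2: "open U2" "U2 \<inter> {a..b} = \<gamma> -` cdom d \<inter> {a..b}"
      by (rule exE[OF cont\<gamma>[unfolded continuous_on_open_invariant, rule_format]]) (elim conjE, rule that)
    define U where "U = U1 \<inter> U2"
    have U: "open U" "t \<in> U"
    proof -
      show "open U" unfolding U_def using U1(1) U2(1) by (rule open_Int)
      have "t \<in> U1 \<inter> {a..b}" "t \<in> U2 \<inter> {a..b}"
        unfolding U1(2) U2(2) using that W(2) tab by (auto simp: S_def)
      then show "t \<in> U" by (simp add: U_def)
    qed
    have inU: "\<sigma> \<in> S" "x \<sigma> \<in> W" if "\<sigma> \<in> U \<inter> {a..b}" for \<sigma>
    proof -
      have "\<sigma> \<in> U1 \<inter> {a..b}" "\<sigma> \<in> U2 \<inter> {a..b}" using that by (auto simp: U_def)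
      then show "\<sigma> \<in> S" "x \<sigma> \<in> W" unfolding U1(2) U2(2) S_def by auto
    qed
    have Feq: "F (x \<sigma>) = cmap d (\<gamma> \<sigma>)" if "\<sigma> \<in> U \<inter> {a..b}" for \<sigma>
      using bspec[OF W(4), of "x \<sigma>"] inU[OF that] overlap[of \<sigma>] by (simp add: transition_def \<gamma>_def)
    have main: "((\<lambda>\<sigma>. cmap d (\<gamma> \<sigma>)) has_vector_derivative frechet_derivative F (at (x \<sigma>)) (v \<sigma>))
           (at \<sigma> within {a..b}) \<and> P d (\<gamma> \<sigma>) (frechet_derivative F (at (x \<sigma>)) (v \<sigma>))"
      if s: "\<sigma> \<in> U \<inter> {a..b}" for \<sigma>
    proof
      let ?L = "frechet_derivative F (at (x \<sigma>))"
      have F': "(F has_derivative ?L) (at (x \<sigma>))"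
        by (rule Ck_on_Suc_0_has_derivative[OF F inU(2)[OF s]])
      obtain e where e: "0 < e" "ball \<sigma> e \<subseteq> U" using U(1) s open_contains_ball by blast
      have "((\<lambda>\<sigma>. F (x \<sigma>)) has_vector_derivative ?L (v \<sigma>)) (at \<sigma> within {a..b})"
        using vector_derivative_diff_chain_within[OF deriv has_derivative_at_withinI[OF F']] s
        by (simp add: o_def)
      then show "((\<lambda>\<sigma>. cmap d (\<gamma> \<sigma>)) has_vector_derivative ?L (v \<sigma>)) (at \<sigma> within {a..b})"
        by (rule has_vector_derivative_transform_within[OF _ e(1)])
          (use s e(2) Feq in \<open>auto simp: subset_eq dist_commute\<close>)
      obtain r where r: "0 < r" "ball (x \<sigma>) r \<subseteq> W"
        using W(1) inU(2)[OF s] open_contains_ball by blast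
      \<comment> \<open>Invariance of \<open>P\<close> is phrased with a derivative within the
        overlap; \<open>F\<close> and the transition map agree there near the point.\<close>
      have "(transition c d has_derivative ?L) (at (x \<sigma>) within overlap c d)"
        by (rule has_derivative_transform_within[OF has_derivative_at_withinI[OF F'] r(1)])
          (use overlap[OF inU(1)[OF s]] in \<open>simp_all, use r(2) W(4) in \<open>simp add: subset_eq dist_commute\<close>\<close>)
      then have "transition_derivative c d (\<gamma> \<sigma>) ?L"
        unfolding transition_derivative_def using cm s by simp
      moreover have "\<gamma> \<sigma> \<in> cdom c \<inter> cdom d" using cm(2)[of \<sigma>] s inU(1)[OF s] by (simp add: S_def)
      moreover have "P c (\<gamma> \<sigma>) (v \<sigma>)" using Pv[of \<sigma>] s by (simp add: \<gamma>_def)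
      ultimately show "P d (\<gamma> \<sigma>) (?L (v \<sigma>))"
        using P c d unfolding transition_invariant_def by blast
    qed
    show ?thesis by (rule exI[of _ U], rule exI[of _ F], rule exI[of _ W]) (simp add: U F inU main del: Ck_on.simps)
  qed
  have w_eq: "w \<sigma> = z" if "\<sigma> \<in> {a..b}"
    "((\<lambda>\<sigma>. cmap d (\<gamma> \<sigma>)) has_vector_derivative z) (at \<sigma> within {a..b})" for \<sigma> z
    unfolding w_def by (rule vector_derivative_within_closed_interval[OF \<open>a < b\<close> that])
  have "continuous_on S w"
    unfolding continuous_on_eq_continuous_within
  proof
    fix t assume t: "t \<in> S"
    from local[OF t] obtain U F W where U: "open U" "t \<in> U" "Ck_on (Suc 0) W F"
      and UF: "\<forall>\<sigma>\<in>U \<inter> {a..b}. \<sigma> \<in> S \<and> x \<sigma> \<in> W \<and>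
         ((\<lambda>\<sigma>. cmap d (\<gamma> \<sigma>)) has_vector_derivative frechet_derivative F (at (x \<sigma>)) (v \<sigma>)) (at \<sigma> within {a..b}) \<and>
         P d (\<gamma> \<sigma>) (frechet_derivative F (at (x \<sigma>)) (v \<sigma>))"
      by (elim exE conjE) (rule that)
    have sub: "U \<inter> S \<subseteq> {a..b}" by (auto simp: S_def)
    have "continuous_on (U \<inter> S) (\<lambda>\<sigma>. frechet_derivative F (at (x \<sigma>)) (v \<sigma>))"
      by (rule continuous_on_frechet_derivative_Ck[OF U(3)])
        (use UF sub continuous_on_subset[OF contx sub] continuous_on_subset[OF v sub] in blast)+
    moreover have "w \<sigma> = frechet_derivative F (at (x \<sigma>)) (v \<sigma>)" if "\<sigma> \<in> U \<inter> S" for \<sigma>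
      by (rule w_eq[OF subsetD[OF sub that]]) (use UF that sub in blast)
    ultimately have "continuous_on (U \<inter> S) w" by (subst continuous_on_cong[OF refl])
    then have "continuous (at t within U \<inter> S) w"
      using U(2) t by (auto simp: continuous_on_eq_continuous_within)
    moreover have "at t within U \<inter> S = at t within S"
      by (rule at_within_nhd[OF U(2,1)]) auto
    ultimately show "continuous (at t within S) w" by simp
  qed
  moreover have "((\<lambda>\<sigma>. cmap d (\<gamma> \<sigma>)) has_vector_derivative w t) (at t within {a..b}) \<and> P d (\<gamma> t) (w t)"
    if t: "t \<in> {a..b}" "\<gamma> t \<in> cdom d" for t
  proof -
    have "t \<in> S" using t by (simp add: S_def)
    from local[OF this] obtain U F W where "t \<in> U" and UF: "\<forall>\<sigma>\<in>U \<inter> {a..b}. \<sigma> \<in> S \<and> x \<sigma> \<in> W \<and>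
         ((\<lambda>\<sigma>. cmap d (\<gamma> \<sigma>)) has_vector_derivative frechet_derivative F (at (x \<sigma>)) (v \<sigma>)) (at \<sigma> within {a..b}) \<and>
         P d (\<gamma> \<sigma>) (frechet_derivative F (at (x \<sigma>)) (v \<sigma>))"
      by (elim exE conjE) (rule that)
    then have z: "((\<lambda>\<sigma>. cmap d (\<gamma> \<sigma>)) has_vector_derivative frechet_derivative F (at (x t)) (v t)) (at t within {a..b})"
      "P d (\<gamma> t) (frechet_derivative F (at (x t)) (v t))"
      using t(1) by auto
    then show ?thesis using w_eq[OF t(1) z(1)] by simp
  qed
  then have "\<forall>\<tau>\<in>{a..b}. \<gamma> \<tau> \<in> cdom d \<longrightarrow>
      ((\<lambda>\<sigma>. cmap d (\<gamma> \<sigma>)) has_vector_derivative w \<tau>) (at \<tau> within {a..b}) \<and> P d (\<gamma> \<tau>) (w \<tau>)"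
    by blast
  ultimately show "\<exists>v. continuous_on {\<tau>\<in>{a..b}. cinv c (x \<tau>) \<in> cdom d} v \<and>
     (\<forall>\<tau>\<in>{a..b}. cinv c (x \<tau>) \<in> cdom d \<longrightarrow>
        ((\<lambda>\<sigma>. cmap d (cinv c (x \<sigma>))) has_vector_derivative v \<tau>) (at \<tau> within {a..b}) \<and>
        P d (cinv c (x \<tau>)) (v \<tau>))"
    unfolding S_def \<gamma>_def
    by (rule exI[of _ w, OF conjI])
qed

section \<open>Operations on piecewise differentiable curves\<close>

lemma C1_pieceE:
  assumes "C1_piece A P \<gamma> s t" "c \<in> A"
  obtains v where "continuous_on {\<tau>\<in>{s..t}. \<gamma> \<tau> \<in> cdom c} v"
    "\<And>\<tau>. \<tau> \<in> {s..t} \<Longrightarrow> \<gamma> \<tau> \<in> cdom c \<Longrightarrow>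
      ((\<lambda>\<sigma>. cmap c (\<gamma> \<sigma>)) has_vector_derivative v \<tau>) (at \<tau> within {s..t})"
    "\<And>\<tau>. \<tau> \<in> {s..t} \<Longrightarrow> \<gamma> \<tau> \<in> cdom c \<Longrightarrow> P c (\<gamma> \<tau>) (v \<tau>)"
  using assms unfolding C1_piece_def by blast

lemma C1_piece_mono:
  assumes "C1_piece A P \<gamma> s t"
    and "\<And>c p v. c \<in> A \<Longrightarrow> p \<in> cdom c \<Longrightarrow> P c p v \<Longrightarrow> Q c p v"
  shows "C1_piece A Q \<gamma> s t"
  unfolding C1_piece_def
proof
  fix c assume c: "c \<in> A"
  from C1_pieceE[OF assms(1) c] obtain v where "continuous_on {\<tau>\<in>{s..t}. \<gamma> \<tau> \<in> cdom c} v"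
    "\<And>\<tau>. \<tau> \<in> {s..t} \<Longrightarrow> \<gamma> \<tau> \<in> cdom c \<Longrightarrow>
      ((\<lambda>\<sigma>. cmap c (\<gamma> \<sigma>)) has_vector_derivative v \<tau>) (at \<tau> within {s..t})"
    "\<And>\<tau>. \<tau> \<in> {s..t} \<Longrightarrow> \<gamma> \<tau> \<in> cdom c \<Longrightarrow> P c (\<gamma> \<tau>) (v \<tau>)" by blast
  then show "\<exists>v. continuous_on {\<tau>\<in>{s..t}. \<gamma> \<tau> \<in> cdom c} v \<and>
     (\<forall>\<tau>\<in>{s..t}. \<gamma> \<tau> \<in> cdom c \<longrightarrow>
        ((\<lambda>\<sigma>. cmap c (\<gamma> \<sigma>)) has_vector_derivative v \<tau>) (at \<tau> within {s..t}) \<and> Q c (\<gamma> \<tau>) (v \<tau>))"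
    using assms(2)[OF c] by (intro exI[of _ v]) simp
qed

lemma C1_piece_subinterval:
  assumes "C1_piece A P \<gamma> a b" "a \<le> s" "t \<le> b"
  shows "C1_piece A P \<gamma> s t"
  unfolding C1_piece_def
proof
  fix c assume c: "c \<in> A"
  have sub: "{s..t} \<subseteq> {a..b}" using assms by simp
  from C1_pieceE[OF assms(1) c] obtain v where v: "continuous_on {\<tau>\<in>{a..b}. \<gamma> \<tau> \<in> cdom c} v"
    "\<And>\<tau>. \<tau> \<in> {a..b} \<Longrightarrow> \<gamma> \<tau> \<in> cdom c \<Longrightarrow>
      ((\<lambda>\<sigma>. cmap c (\<gamma> \<sigma>)) has_vector_derivative v \<tau>) (at \<tau> within {a..b})"
    "\<And>\<tau>. \<tau> \<in> {a..b} \<Longrightarrow> \<gamma> \<tau> \<in> cdom c \<Longrightarrow> P c (\<gamma> \<tau>) (v \<tau>)" by blast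
  have "continuous_on {\<tau>\<in>{s..t}. \<gamma> \<tau> \<in> cdom c} v"
    by (rule continuous_on_subset[OF v(1)]) (use sub in auto)
  moreover have "((\<lambda>\<sigma>. cmap c (\<gamma> \<sigma>)) has_vector_derivative v \<tau>) (at \<tau> within {s..t})"
    "P c (\<gamma> \<tau>) (v \<tau>)" if "\<tau> \<in> {s..t}" "\<gamma> \<tau> \<in> cdom c" for \<tau>
    using has_vector_derivative_within_subset[OF v(2) sub] v(3) that sub by auto
  ultimately show "\<exists>v. continuous_on {\<tau>\<in>{s..t}. \<gamma> \<tau> \<in> cdom c} v \<and>
     (\<forall>\<tau>\<in>{s..t}. \<gamma> \<tau> \<in> cdom c \<longrightarrow>
        ((\<lambda>\<sigma>. cmap c (\<gamma> \<sigma>)) has_vector_derivative v \<tau>) (at \<tau> within {s..t}) \<and> P c (\<gamma> \<tau>) (v \<tau>))"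
    by blast
qed

lemma C1_piece_cong:
  assumes "C1_piece A P \<gamma> s t" and eq: "\<And>\<tau>. \<tau> \<in> {s..t} \<Longrightarrow> \<gamma>' \<tau> = \<gamma> \<tau>"
  shows "C1_piece A P \<gamma>' s t"
  unfolding C1_piece_def
proof
  fix c assume c: "c \<in> A"
  from C1_pieceE[OF assms(1) c] obtain v where v: "continuous_on {\<tau>\<in>{s..t}. \<gamma> \<tau> \<in> cdom c} v"
    "\<And>\<tau>. \<tau> \<in> {s..t} \<Longrightarrow> \<gamma> \<tau> \<in> cdom c \<Longrightarrow>
      ((\<lambda>\<sigma>. cmap c (\<gamma> \<sigma>)) has_vector_derivative v \<tau>) (at \<tau> within {s..t})"
    "\<And>\<tau>. \<tau> \<in> {s..t} \<Longrightarrow> \<gamma> \<tau> \<in> cdom c \<Longrightarrow> P c (\<gamma> \<tau>) (v \<tau>)" by blast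
  have "continuous_on {\<tau>\<in>{s..t}. \<gamma>' \<tau> \<in> cdom c} v"
    by (rule continuous_on_subset[OF v(1)]) (use eq in auto)
  moreover have "((\<lambda>\<sigma>. cmap c (\<gamma>' \<sigma>)) has_vector_derivative v \<tau>) (at \<tau> within {s..t}) \<and> P c (\<gamma>' \<tau>) (v \<tau>)"
    if \<tau>: "\<tau> \<in> {s..t}" "\<gamma>' \<tau> \<in> cdom c" for \<tau>
  proof
    have \<tau>': "\<gamma> \<tau> \<in> cdom c" using \<tau> eq by simp
    show "((\<lambda>\<sigma>. cmap c (\<gamma>' \<sigma>)) has_vector_derivative v \<tau>) (at \<tau> within {s..t})"
      by (rule has_vector_derivative_transform[OF \<tau>(1) _ v(2)[OF \<tau>(1) \<tau>']]) (simp add: eq)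
    show "P c (\<gamma>' \<tau>) (v \<tau>)" using v(3)[OF \<tau>(1) \<tau>'] eq[OF \<tau>(1)] by simp
  qed
  ultimately show "\<exists>v. continuous_on {\<tau>\<in>{s..t}. \<gamma>' \<tau> \<in> cdom c} v \<and>
     (\<forall>\<tau>\<in>{s..t}. \<gamma>' \<tau> \<in> cdom c \<longrightarrow>
        ((\<lambda>\<sigma>. cmap c (\<gamma>' \<sigma>)) has_vector_derivative v \<tau>) (at \<tau> within {s..t}) \<and> P c (\<gamma>' \<tau>) (v \<tau>))"
    by blast
qed

lemma C1_piece_shift:
  assumes "C1_piece A P \<gamma> s t"
  shows "C1_piece A P (\<lambda>\<tau>. \<gamma> (\<tau> + k)) (s - k) (t - k)"
  unfolding C1_piece_def
proof
  fix c assume c: "c \<in> A"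
  from C1_pieceE[OF assms(1) c] obtain v where v: "continuous_on {\<tau>\<in>{s..t}. \<gamma> \<tau> \<in> cdom c} v"
    "\<And>\<tau>. \<tau> \<in> {s..t} \<Longrightarrow> \<gamma> \<tau> \<in> cdom c \<Longrightarrow>
      ((\<lambda>\<sigma>. cmap c (\<gamma> \<sigma>)) has_vector_derivative v \<tau>) (at \<tau> within {s..t})"
    "\<And>\<tau>. \<tau> \<in> {s..t} \<Longrightarrow> \<gamma> \<tau> \<in> cdom c \<Longrightarrow> P c (\<gamma> \<tau>) (v \<tau>)" by blast
  have "continuous_on {\<tau>\<in>{s - k..t - k}. \<gamma> (\<tau> + k) \<in> cdom c} (\<lambda>\<tau>. v (\<tau> + k))"
    by (rule continuous_on_compose2[OF v(1)]) (auto intro!: continuous_intros)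
  moreover have "((\<lambda>\<sigma>. cmap c (\<gamma> (\<sigma> + k))) has_vector_derivative v (\<tau> + k)) (at \<tau> within {s - k..t - k}) \<and>
      P c (\<gamma> (\<tau> + k)) (v (\<tau> + k))"
    if \<tau>: "\<tau> \<in> {s - k..t - k}" "\<gamma> (\<tau> + k) \<in> cdom c" for \<tau>
  proof
    have \<tau>': "\<tau> + k \<in> {s..t}" using \<tau> by simp
    have img: "(\<lambda>\<sigma>. \<sigma> + k) ` {s - k..t - k} = {s..t}" by simp
    have "((\<lambda>\<sigma>. \<sigma> + k) has_vector_derivative 1) (at \<tau> within {s - k..t - k})"
      by (auto intro!: derivative_eq_intros)
    from vector_diff_chain_within[OF this, unfolded img, OF v(2)[OF \<tau>' \<tau>(2)]]
    show "((\<lambda>\<sigma>. cmap c (\<gamma> (\<sigma> + k))) has_vector_derivative v (\<tau> + k)) (at \<tau> within {s - k..t - k})"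
      by (simp add: o_def)
    show "P c (\<gamma> (\<tau> + k)) (v (\<tau> + k))" by (rule v(3)[OF \<tau>' \<tau>(2)])
  qed
  ultimately show "\<exists>v. continuous_on {\<tau>\<in>{s - k..t - k}. \<gamma> (\<tau> + k) \<in> cdom c} v \<and>
     (\<forall>\<tau>\<in>{s - k..t - k}. \<gamma> (\<tau> + k) \<in> cdom c \<longrightarrow>
        ((\<lambda>\<sigma>. cmap c (\<gamma> (\<sigma> + k))) has_vector_derivative v \<tau>) (at \<tau> within {s - k..t - k}) \<and>
        P c (\<gamma> (\<tau> + k)) (v \<tau>))"
    by (intro exI[of _ "\<lambda>\<tau>. v (\<tau> + k)"]) blast
qed

lemma curve_inE:
  assumes "curve_in A P S \<gamma> a b"
  obtains F where "a < b" "continuous_on {a..b} \<gamma>" "\<gamma> ` {a..b} \<subseteq> S" "finite F"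
    "\<And>s t. a \<le> s \<Longrightarrow> s < t \<Longrightarrow> t \<le> b \<Longrightarrow> {s<..<t} \<inter> F = {} \<Longrightarrow> C1_piece A P \<gamma> s t"
  using assms unfolding curve_in_def by blast

lemma curve_in_mono:
  assumes "curve_in A P S \<gamma> a b" "S \<subseteq> S'"
    and "\<And>c p v. c \<in> A \<Longrightarrow> p \<in> cdom c \<Longrightarrow> P c p v \<Longrightarrow> Q c p v"
  shows "curve_in A Q S' \<gamma> a b"
proof -
  from curve_inE[OF assms(1)] obtain F where F: "a < b" "continuous_on {a..b} \<gamma>" "\<gamma> ` {a..b} \<subseteq> S" "finite F"
    "\<And>s t. a \<le> s \<Longrightarrow> s < t \<Longrightarrow> t \<le> b \<Longrightarrow> {s<..<t} \<inter> F = {} \<Longrightarrow> C1_piece A P \<gamma> s t" by blast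
  have "C1_piece A Q \<gamma> s t" if "a \<le> s" "s < t" "t \<le> b" "{s<..<t} \<inter> F = {}" for s t
    by (rule C1_piece_mono[OF F(5)[OF that] assms(3)])
  then show ?thesis using F(1-4) assms(2) unfolding curve_in_def by blast
qed

lemma curve_in_subinterval:
  assumes "curve_in A P S \<gamma> a b" "a \<le> s" "s < t" "t \<le> b"
  shows "curve_in A P S \<gamma> s t"
proof -
  from curve_inE[OF assms(1)] obtain F where F: "a < b" "continuous_on {a..b} \<gamma>" "\<gamma> ` {a..b} \<subseteq> S" "finite F"
    "\<And>s t. a \<le> s \<Longrightarrow> s < t \<Longrightarrow> t \<le> b \<Longrightarrow> {s<..<t} \<inter> F = {} \<Longrightarrow> C1_piece A P \<gamma> s t" by blast
  have sub: "{s..t} \<subseteq> {a..b}" using assms by simp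
  have "C1_piece A P \<gamma> s' t'" if "s \<le> s'" "s' < t'" "t' \<le> t" "{s'<..<t'} \<inter> F = {}" for s' t'
    by (rule F(5)) (use that assms in auto)
  then show ?thesis
    unfolding curve_in_def using continuous_on_subset[OF F(2) sub] F(3,4) sub assms(3) by blast
qed

lemma curve_in_C1_piece:
  assumes "C1_piece A P \<gamma> a b" "a < b" "continuous_on {a..b} \<gamma>" "\<gamma> ` {a..b} \<subseteq> S"
  shows "curve_in A P S \<gamma> a b"
proof -
  have "C1_piece A P \<gamma> s t" if "a \<le> s" "t \<le> b" for s t
    by (rule C1_piece_subinterval[OF assms(1) that])
  then show ?thesis unfolding curve_in_def using assms(2-4) by blast
qed

lemma curve_in_shift:
  assumes "curve_in A P S \<gamma> a b"
  shows "curve_in A P S (\<lambda>\<tau>. \<gamma> (\<tau> + k)) (a - k) (b - k)"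
proof -
  from curve_inE[OF assms(1)] obtain F where F: "a < b" "continuous_on {a..b} \<gamma>" "\<gamma> ` {a..b} \<subseteq> S" "finite F"
    "\<And>s t. a \<le> s \<Longrightarrow> s < t \<Longrightarrow> t \<le> b \<Longrightarrow> {s<..<t} \<inter> F = {} \<Longrightarrow> C1_piece A P \<gamma> s t" by blast
  have "continuous_on {a - k..b - k} (\<lambda>\<tau>. \<gamma> (\<tau> + k))"
    by (rule continuous_on_compose2[OF F(2)]) (auto intro!: continuous_intros)
  moreover have "(\<lambda>\<tau>. \<gamma> (\<tau> + k)) ` {a - k..b - k} \<subseteq> S" using F(3) by (auto simp: image_subset_iff)
  moreover have "C1_piece A P (\<lambda>\<tau>. \<gamma> (\<tau> + k)) s t"
    if st: "a - k \<le> s" "s < t" "t \<le> b - k" "{s<..<t} \<inter> (\<lambda>x. x - k) ` F = {}" for s t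
  proof -
    have "{s + k<..<t + k} \<inter> F = {}"
    proof (rule ccontr)
      assume "\<not> ?thesis"
      then obtain x where "x \<in> F" "s + k < x" "x < t + k" by auto
      then have "x - k \<in> {s<..<t} \<inter> (\<lambda>x. x - k) ` F" by auto
      then show False using st(4) by blast
    qed
    then have "C1_piece A P \<gamma> (s + k) (t + k)" by (intro F(5)) (use st in auto)
    from C1_piece_shift[OF this, of k] show ?thesis by simp
  qed
  ultimately show ?thesis
    unfolding curve_in_def using F(1,4) by (intro conjI exI[of _ "(\<lambda>x. x - k) ` F"]) auto
qed

lemma curve_in_append:
  assumes c1: "curve_in A P S \<gamma>1 a b" and c2: "curve_in A P S \<gamma>2 b d" and eq: "\<gamma>1 b = \<gamma>2 b"
  shows "curve_in A P S (\<lambda>t. if t \<le> b then \<gamma>1 t else \<gamma>2 t) a d"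
proof -
  let ?\<gamma> = "\<lambda>t. if t \<le> b then \<gamma>1 t else \<gamma>2 t"
  from curve_inE[OF c1] obtain F1 where F1: "a < b" "continuous_on {a..b} \<gamma>1" "\<gamma>1 ` {a..b} \<subseteq> S" "finite F1"
    "\<And>s t. a \<le> s \<Longrightarrow> s < t \<Longrightarrow> t \<le> b \<Longrightarrow> {s<..<t} \<inter> F1 = {} \<Longrightarrow> C1_piece A P \<gamma>1 s t" by blast
  from curve_inE[OF c2] obtain F2 where F2: "b < d" "continuous_on {b..d} \<gamma>2" "\<gamma>2 ` {b..d} \<subseteq> S" "finite F2"
    "\<And>s t. b \<le> s \<Longrightarrow> s < t \<Longrightarrow> t \<le> d \<Longrightarrow> {s<..<t} \<inter> F2 = {} \<Longrightarrow> C1_piece A P \<gamma>2 s t" by blast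
  have "continuous_on ({a..b} \<union> {b..d}) ?\<gamma>"
    by (rule continuous_on_cases[OF _ _ F1(2) F2(2)]) (use eq in auto)
  moreover have "{a..b} \<union> {b..d} = {a..d}" using F1(1) F2(1) by auto
  ultimately have "continuous_on {a..d} ?\<gamma>" by simp
  moreover have "?\<gamma> ` {a..d} \<subseteq> S" using F1(3) F2(3) by (auto simp: image_subset_iff)
  \<comment> \<open>The junction \<open>b\<close> joins the break points, so that no piece to be
    checked straddles it.\<close>
  moreover have "C1_piece A P ?\<gamma> s t"
    if st: "a \<le> s" "s < t" "t \<le> d" "{s<..<t} \<inter> insert b (F1 \<union> F2) = {}" for s t
  proof (cases "t \<le> b")
    case True
    have "C1_piece A P \<gamma>1 s t" by (rule F1(5)) (use st True in auto)
    then show ?thesis by (rule C1_piece_cong) (use True in auto)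
  next
    case False
    then have bs: "b \<le> s" using st(4) by (metis IntI empty_iff greaterThanLessThan_iff insertI1 not_le)
    have "C1_piece A P \<gamma>2 s t" by (rule F2(5)) (use st bs in auto)
    then show ?thesis by (rule C1_piece_cong) (use bs eq order.antisym in fastforce)
  qed
  moreover have "finite (insert b (F1 \<union> F2))" using F1(4) F2(4) by simp
  ultimately show ?thesis
    unfolding curve_in_def using F1(1) F2(1) by (metis (no_types, lifting) order.strict_trans)
qed

text \<open>A shift of the parameter makes the two domains adjacent. The last clause records that
  the joined curve visits the junction; the final contradiction with strong causality rests on such
  an intermediate point.\<close>

lemma curve_in_join:
  assumes c1: "curve_in A P S \<gamma>1 a b" and c2: "curve_in A P S \<gamma>2 a' b'" and eq: "\<gamma>1 b = \<gamma>2 a'"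
  obtains \<gamma> d where "curve_in A P S \<gamma> a d" "\<gamma> a = \<gamma>1 a" "\<gamma> d = \<gamma>2 b'" "\<gamma>1 b \<in> \<gamma> ` {a..d}"
proof -
  define k where "k = a' - b"
  have c2': "curve_in A P S (\<lambda>\<tau>. \<gamma>2 (\<tau> + k)) b (b' - k)"
    using curve_in_shift[OF c2, of k] by (simp add: k_def)
  have ab: "a < b" "b < b' - k" using c1 c2' by (auto simp: curve_in_def)
  let ?\<gamma> = "\<lambda>t. if t \<le> b then \<gamma>1 t else \<gamma>2 (t + k)"
  have "curve_in A P S ?\<gamma> a (b' - k)"
    by (rule curve_in_append[OF c1 c2']) (simp add: eq k_def)
  moreover have "?\<gamma> a = \<gamma>1 a" "?\<gamma> (b' - k) = \<gamma>2 b'" using ab by auto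
  moreover have "\<gamma>1 b \<in> ?\<gamma> ` {a..b' - k}" by (rule image_eqI[of _ _ b]) (use ab in auto)
  ultimately show thesis by (rule that)
qed

section \<open>Null generators\<close>

text \<open>The equation is solved backwards from \<open>y1\<close> and then reversed. Throughout,
  the velocity has a definite component along the central value \<open>\<xi> y0\<close>, so the
  displacement within time \<open>h\<close> is at least the diameter of the small open ball. One
  \<open>h\<close> and one \<open>\<delta>\<close> serve all end points \<open>y1\<close>.\<close>

lemma flow_into_ball:
  fixes \<xi> :: "'e::euclidean_space \<Rightarrow> 'e"
  assumes lip: "L-lipschitz_on (cball y0 \<rho>) \<xi>" and "0 < \<rho>" and nz: "\<xi> y0 \<noteq> 0"
  obtains h \<delta> where "0 < h" "0 < \<delta>"
    "\<And>y1. y1 \<in> ball y0 \<delta> \<Longrightarrow> \<exists>y. y h = y1 \<and> y 0 \<notin> ball y0 \<delta> \<and>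
       (\<forall>t\<in>{0..h}. y t \<in> cball y0 \<rho> \<and> (y has_vector_derivative \<xi> (y t)) (at t within {0..h}))"
proof -
  let ?n = "\<xi> y0"
  define K where "K = L + 1"
  have L0: "0 \<le> L" using lip lipschitz_on_nonneg by blast
  have lipd: "norm (\<xi> y - \<xi> z) \<le> L * norm (y - z)" if "y \<in> cball y0 \<rho>" "z \<in> cball y0 \<rho>" for y z
    using lipschitz_onD[OF lip that] by (simp add: dist_norm)
  \<comment> \<open>On this smaller ball \<open>\<xi>\<close> differs from its central value by at
    most half the norm of the latter. \<open>K\<close> replaces \<open>L\<close> to have a positive
    divisor.\<close>
  define \<rho>' where "\<rho>' = min \<rho> (norm ?n / (2 * K))"
  have K: "0 < K" using L0 by (simp add: K_def)
  have \<rho>': "0 < \<rho>'" "\<rho>' \<le> \<rho>" "\<rho>' * K \<le> norm ?n / 2"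
    using \<open>0 < \<rho>\<close> nz K by (auto simp: \<rho>'_def min_def field_simps)
  have close: "norm (\<xi> y - ?n) \<le> norm ?n / 2" if "y \<in> cball y0 \<rho>'" for y
  proof -
    have "norm (\<xi> y - ?n) \<le> L * norm (y - y0)" by (rule lipd) (use that \<rho>' \<open>0 < \<rho>\<close> in auto)
    also have "\<dots> \<le> K * \<rho>'"
      using that L0 by (intro mult_mono) (auto simp: K_def dist_norm norm_minus_commute)
    finally show ?thesis using \<rho>'(3) by (simp add: mult.commute)
  qed
  define M where "M = 2 * norm ?n"
  have M: "0 < M" using nz by (simp add: M_def)
  have bound: "norm (\<xi> y) \<le> M" if "y \<in> cball y0 \<rho>'" for y
    using close[OF that] norm_triangle_sub[of "\<xi> y" ?n] norm_ge_zero[of ?n] unfolding M_def by linarith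
  have away: "(norm ?n)\<^sup>2 / 2 \<le> \<xi> y \<bullet> ?n" if "y \<in> cball y0 \<rho>'" for y
  proof -
    have "\<bar>(\<xi> y - ?n) \<bullet> ?n\<bar> \<le> norm (\<xi> y - ?n) * norm ?n" by (rule Cauchy_Schwarz_ineq2)
    also have "\<dots> \<le> norm ?n / 2 * norm ?n" using close[OF that] by (intro mult_right_mono) auto
    finally have "- ((\<xi> y - ?n) \<bullet> ?n) \<le> norm ?n / 2 * norm ?n" by (rule abs_le_D2)
    then show ?thesis by (simp add: inner_diff_left dot_square_norm power2_eq_square)
  qed
  \<comment> \<open>The nearest point projection is 1-Lipschitz, so composing with it extends the
    field to the whole space with the same constant and the same bounds. \<open>f\<close> also
    carries the sign of the backward flow.\<close>
  define cl where "cl = closest_point (cball y0 \<rho>')"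
  have cball: "convex (cball y0 \<rho>')" "closed (cball y0 \<rho>')" "cball y0 \<rho>' \<noteq> {}" using \<rho>' by auto
  have cl: "cl y \<in> cball y0 \<rho>'" for y
    unfolding cl_def by (rule closest_point_in_set[OF cball(2,3)])
  have cl_id: "cl y = y" if "y \<in> cball y0 \<rho>'" for y
    unfolding cl_def by (rule closest_point_self[OF that])
  define f where "f y = - \<xi> (cl y)" for y
  have f_lip: "L-lipschitz_on UNIV f"
  proof (rule lipschitz_onI)
    fix y z :: 'e
    have "dist (f y) (f z) = norm (\<xi> (cl y) - \<xi> (cl z))"
      by (simp add: f_def dist_norm norm_minus_commute)
    also have "\<dots> \<le> L * norm (cl y - cl z)"
      by (rule lipd) (use cl \<rho>'(2) in \<open>auto intro: order_trans\<close>)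
    also have "\<dots> \<le> L * dist y z"
      using closest_point_lipschitz[OF cball] L0 unfolding cl_def dist_norm[symmetric]
      by (intro mult_left_mono)
    finally show "dist (f y) (f z) \<le> L * dist y z" .
  qed (rule L0)
  \<comment> \<open>The first bound makes the Picard operator contract, the second limits the
    displacement to half of \<open>\<rho>'\<close>.\<close>
  define h where "h = min (1 / (2 * K)) (\<rho>' / (2 * M))"
  have h: "0 < h" "h * L < 1" "h * M \<le> \<rho>' / 2"
  proof -
    show "0 < h" using K M \<rho>'(1) by (simp add: h_def)
    have "h * L \<le> 1 / (2 * K) * K" using K L0 \<open>0 < h\<close> by (intro mult_mono) (auto simp: h_def K_def)
    then show "h * L < 1" using K by simp
    have "h * M \<le> \<rho>' / (2 * M) * M" using M by (intro mult_right_mono) (auto simp: h_def)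
    then show "h * M \<le> \<rho>' / 2" using M by simp
  qed
  \<comment> \<open>The first term leaves room for that displacement around any start in the small
    ball; the second makes its diameter at most the guaranteed displacement
    \<open>h * norm (\<xi> y0) / 2\<close>.\<close>
  define \<delta> where "\<delta> = min (\<rho>' / 2) (h * norm ?n / 4)"
  have \<delta>: "0 < \<delta>" "\<delta> \<le> \<rho>' / 2" "2 * \<delta> \<le> h * norm ?n / 2"
    using h(1) nz \<rho>'(1) by (auto simp: \<delta>_def)
  have "\<exists>y. y h = y1 \<and> y 0 \<notin> ball y0 \<delta> \<and>
       (\<forall>t\<in>{0..h}. y t \<in> cball y0 \<rho> \<and> (y has_vector_derivative \<xi> (y t)) (at t within {0..h}))"
    if y1: "y1 \<in> ball y0 \<delta>" for y1
  proof -
    obtain z where z: "z 0 = y1" "\<And>t. t \<in> {0..h} \<Longrightarrow> (z has_vector_derivative f (z t)) (at t within {0..h})"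
      by (rule picard_lipschitz[OF f_lip h(1,2)]) blast
    \<comment> \<open>The mean value theorem with equality is for scalar functions, so the
      displacement is tested against a fixed \<open>w\<close>: against itself it yields the speed
      bound, against \<open>\<xi> y0\<close> the escape. Both bounds hold for \<open>f\<close>
      everywhere, hence before it is known that \<open>z\<close> stays in the ball.\<close>
    have mvt: "\<exists>s. (z t - z 0) \<bullet> w = (f (z s) \<bullet> w) * t" if t: "t \<in> {0..h}" for t w
    proof (cases "t = 0")
      case False
      have "\<exists>s\<in>{0<..<t}. z t \<bullet> w - z 0 \<bullet> w = (\<lambda>r. r * (f (z s) \<bullet> w)) (t - 0)"
      proof (rule mvt_simple)
        fix s assume s: "0 \<le> s" "s \<le> t"
        have "(z has_vector_derivative f (z s)) (at s within {0..t})"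
          by (rule has_vector_derivative_within_subset[OF z(2)]) (use s t in auto)
        then have "(z has_derivative (\<lambda>r. r *\<^sub>R f (z s))) (at s within {0..t})"
          by (simp add: has_vector_derivative_def)
        from has_derivative_inner_left[OF this, of w]
        show "((\<lambda>r. z r \<bullet> w) has_derivative (\<lambda>r. r * (f (z s) \<bullet> w))) (at s within {0..t})" by simp
      qed (use t False in auto)
      then show ?thesis by (auto simp: inner_diff_left mult.commute)
    qed simp
    have z_in: "z t \<in> cball y0 \<rho>'" if t: "t \<in> {0..h}" for t
    proof -
      let ?w = "z t - z 0"
      from mvt[OF t, of ?w] obtain s where s: "?w \<bullet> ?w = (f (z s) \<bullet> ?w) * t" by blast
      have "f (z s) \<bullet> ?w \<le> M * norm ?w"
        using Cauchy_Schwarz_ineq2[of "f (z s)" ?w] bound[OF cl, of "z s"]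
        by (smt (verit) f_def mult_right_mono norm_ge_zero norm_minus_cancel)
      then have "(norm ?w)\<^sup>2 \<le> (M * norm ?w) * t"
        using t s by (simp add: dot_square_norm mult_right_mono)
      also have "\<dots> \<le> (M * norm ?w) * h" using t M by (intro mult_left_mono) auto
      finally have "norm ?w * norm ?w \<le> norm ?w * (h * M)" by (simp add: power2_eq_square mult_ac)
      then have "norm ?w \<le> \<rho>' / 2" using h(3) \<rho>'(1) by (cases "norm ?w = 0") auto
      moreover have "norm (z 0 - y0) \<le> \<rho>' / 2" using y1 z(1) \<delta>(2) by (simp add: dist_norm norm_minus_commute)
      moreover have "norm (z t - y0) \<le> norm ?w + norm (z 0 - y0)"
        using norm_triangle_ineq[of ?w "z 0 - y0"] by simp
      ultimately show ?thesis by (simp add: dist_norm norm_minus_commute)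
    qed
    \<comment> \<open>Having stayed in the ball, the solution never meets the projection and solves
      the original equation with reversed sign.\<close>
    have f_z: "f (z t) = - \<xi> (z t)" if "t \<in> {0..h}" for t using cl_id[OF z_in[OF that]] by (simp add: f_def)
    have "z h \<notin> ball y0 \<delta>"
    proof
      assume zh: "z h \<in> ball y0 \<delta>"
      obtain s where s: "(z h - z 0) \<bullet> ?n = (f (z s) \<bullet> ?n) * h" using mvt[of h ?n] h(1) by auto
      have "(norm ?n)\<^sup>2 / 2 * h \<le> (- f (z s) \<bullet> ?n) * h"
        using away[OF cl, of "z s"] h(1) by (intro mult_right_mono) (auto simp: f_def)
      also have "\<dots> = - ((z h - z 0) \<bullet> ?n)" using s by simp
      also have "\<dots> \<le> norm (z h - z 0) * norm ?n"
        using Cauchy_Schwarz_ineq2[of "z h - z 0" ?n] by linarith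
      finally have "norm ?n * (h * norm ?n / 2) \<le> norm ?n * norm (z h - z 0)"
        by (simp add: power2_eq_square mult_ac)
      then have "h * norm ?n / 2 \<le> norm (z h - z 0)" using nz by simp
      moreover have "norm (z h - z 0) < 2 * \<delta>"
        using zh y1 z(1) dist_triangle3[of "z h" "z 0" y0] by (simp add: dist_norm)
      ultimately show False using \<delta>(3) by linarith
    qed
    moreover have "((\<lambda>t. z (h - t)) has_vector_derivative \<xi> (z (h - t))) (at t within {0..h})"
      if t: "t \<in> {0..h}" for t
    proof -
      have img: "(\<lambda>t. h - t) ` {0..h} = {0..h}" by simp
      have ht: "h - t \<in> {0..h}" using t by simp
      have "((\<lambda>t. h - t) has_vector_derivative -1) (at t within {0..h})"
        by (auto intro!: derivative_eq_intros)
      from vector_diff_chain_within[OF this, unfolded img, OF z(2)[OF ht]]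
      show ?thesis using f_z[OF ht] by (simp add: o_def)
    qed
    moreover have "z (h - t) \<in> cball y0 \<rho>" if "t \<in> {0..h}" for t
      using z_in[of "h - t"] that \<rho>'(2) by auto
    ultimately show ?thesis using z(1) by (intro exI[of _ "\<lambda>t. z (h - t)"]) auto
  qed
  then show thesis using h(1) \<delta>(1) that by blast
qed

text \<open>The Lipschitz radius and constant depend on the arguments \<open>u\<close> and
  \<open>w\<close>; by bilinearity the finitely many pairs of basis vectors suffice.\<close>

lemma smooth_bilinear_locally_lipschitz:
  fixes h :: "'c::euclidean_space \<Rightarrow> 'c \<Rightarrow> 'c \<Rightarrow> real"
  assumes sm: "\<And>u w. smooth_on S (\<lambda>x. h x u w)" and bil: "\<And>x. x \<in> S \<Longrightarrow> bilinear (h x)"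
    and x0: "x0 \<in> S"
  obtains r D where "0 < r" "0 < D"
    "\<And>x y u w. x \<in> cball x0 r \<inter> S \<Longrightarrow> y \<in> cball x0 r \<inter> S \<Longrightarrow>
       \<bar>h x u w - h y u w\<bar> \<le> D * norm (x - y) * norm u * norm w"
proof -
  have "\<exists>r L. 0 < r \<and> L-lipschitz_on (cball x0 r \<inter> S) (\<lambda>x. h x u w)" for u w
    using smooth_on_locally_lipschitz[OF sm x0] by metis
  then obtain R L where RL: "\<And>u w. 0 < R u w" "\<And>u w. (L u w)-lipschitz_on (cball x0 (R u w) \<inter> S) (\<lambda>x. h x u w)"
    by metis
  define r where "r = Min ((\<lambda>(i, j). R i j) ` (Basis \<times> Basis))"
  \<comment> \<open>The summand 1 makes \<open>D\<close> strictly positive, so that it can serve as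
    a divisor later.\<close>
  define D where "D = 1 + (\<Sum>i\<in>Basis. \<Sum>j\<in>Basis. L i j)"
  have fin: "finite ((\<lambda>(i, j). R i j) ` (Basis \<times> (Basis :: 'c set)))" by simp
  have r_le: "r \<le> R i j" if "i \<in> Basis" "j \<in> Basis" for i j
    unfolding r_def by (rule Min_le[OF fin]) (use that in auto)
  have "0 < r" unfolding r_def by (subst Min_gr_iff[OF fin]) (auto simp: RL(1))
  moreover have "0 \<le> L i j" for i j using RL(2) lipschitz_on_nonneg by blast
  then have "0 < D" unfolding D_def by (intro add_pos_nonneg sum_nonneg) auto
  moreover have "\<bar>h x u w - h y u w\<bar> \<le> D * norm (x - y) * norm u * norm w"
    if xy: "x \<in> cball x0 r \<inter> S" "y \<in> cball x0 r \<inter> S" for x y u w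
  proof -
    note expand = bilinear_expand_Basis[OF bil]
    have "h x u w - h y u w = (\<Sum>i\<in>Basis. \<Sum>j\<in>Basis. (u \<bullet> i) * (w \<bullet> j) * (h x i j - h y i j))"
      using xy expand[of x u w] expand[of y u w] by (simp add: sum_subtractf right_diff_distrib)
    also have "\<bar>\<dots>\<bar> \<le> (\<Sum>i\<in>Basis. \<Sum>j\<in>Basis. \<bar>(u \<bullet> i) * (w \<bullet> j) * (h x i j - h y i j)\<bar>)"
      by (rule order_trans[OF sum_abs]) (intro sum_mono sum_abs)
    also have "\<dots> \<le> (\<Sum>i\<in>Basis. \<Sum>j\<in>Basis. L i j * (norm (x - y) * norm u * norm w))"
    proof (intro sum_mono)
      fix i j :: 'c assume ij: "i \<in> Basis" "j \<in> Basis"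
      have "\<bar>h x i j - h y i j\<bar> \<le> L i j * norm (x - y)"
        using lipschitz_onD[OF RL(2)[of i j], of x y] xy r_le[OF ij] by (simp add: dist_norm)
      moreover have "\<bar>u \<bullet> i\<bar> * \<bar>w \<bullet> j\<bar> \<le> norm u * norm w"
        using ij by (intro mult_mono) (auto simp: Basis_le_norm)
      ultimately have "(\<bar>u \<bullet> i\<bar> * \<bar>w \<bullet> j\<bar>) * \<bar>h x i j - h y i j\<bar> \<le> (norm u * norm w) * (L i j * norm (x - y))"
        by (subst mult.commute, subst (2) mult.commute) (rule mult_mono, auto intro: order_trans[OF abs_ge_zero])
      then show "\<bar>(u \<bullet> i) * (w \<bullet> j) * (h x i j - h y i j)\<bar> \<le> L i j * (norm (x - y) * norm u * norm w)"
        by (simp add: abs_mult mult_ac)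
    qed
    also have "\<dots> = (D - 1) * (norm (x - y) * norm u * norm w)"
      by (simp add: D_def sum_distrib_right)
    also have "\<dots> \<le> D * (norm (x - y) * norm u * norm w)" by (intro mult_right_mono) auto
    finally show ?thesis by (simp add: mult_ac)
  qed
  ultimately show thesis using that by blast
qed

section \<open>Gradients with respect to a Lorentzian form\<close>

lemma lorentzian_form_matrix:
  fixes h :: "'c::euclidean_space \<Rightarrow> 'c \<Rightarrow> real"
  assumes lor: "lorentzian_form h"
  obtains G where "linear G" "inj G" "\<And>u w. G u \<bullet> w = h u w"
proof -
  have bil: "bilinear h" using lor by (simp add: lorentzian_form_def)
  define G where "G u = (\<Sum>b\<in>Basis. h u b *\<^sub>R b)" for u
  have G: "G u \<bullet> w = h u w" for u w
  proof -
    have "h u w = (\<Sum>b\<in>Basis. (w \<bullet> b) * h u b)"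
      using bilinear_sum_scaleR_right[OF bil, of u "\<lambda>i. w \<bullet> i" "\<lambda>i. i" Basis]
      by (simp add: euclidean_representation)
    then show ?thesis by (simp add: G_def inner_sum_left mult.commute inner_commute[of w])
  qed
  have linG: "linear G"
    by (rule linearI; rule vector_eq_rdot[THEN iffD1])
      (simp_all add: inner_add_left G bilinear_ladd[OF bil] bilinear_lmul[OF bil])
  have "inj G"
    unfolding linear_injective_0[OF linG]
  proof (intro allI impI)
    fix u assume "G u = 0"
    then have "h u w = 0" for w using G[of u w] by simp
    then show "u = 0" by (rule lorentzian_form_nondegenerate[OF lor])
  qed
  then show thesis using linG G that by blast
qed

text \<open>Raising an index: \<open>X\<close> is the gradient, with respect to \<open>h\<close>, of
  the linear function given by \<open>l\<close>. The matrix of \<open>h\<close> is injective, hence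
  surjective in finite dimension.\<close>

lemma lorentzian_form_represents:
  fixes h :: "'c::euclidean_space \<Rightarrow> 'c \<Rightarrow> real"
  assumes "lorentzian_form h"
  obtains X where "\<And>w. h X w = l \<bullet> w"
proof -
  obtain G where G: "linear G" "inj G" "\<And>u w. G u \<bullet> w = h u w"
    by (rule lorentzian_form_matrix[OF assms]) blast
  obtain X where "l = G X" using linear_injective_imp_surjective[OF G(1,2)] by blast
  then show thesis using G(3) that by metis
qed

text \<open>The matrix of \<open>h x\<close> stays uniformly invertible near \<open>x0\<close>, so inversion preserves Lipschitz
  continuity.\<close>

lemma gradient_locally_lipschitz:
  fixes h :: "'c::euclidean_space \<Rightarrow> 'c \<Rightarrow> 'c \<Rightarrow> real"
  assumes sm: "\<And>u w. smooth_on S (\<lambda>x. h x u w)" and lor: "\<And>x. x \<in> S \<Longrightarrow> lorentzian_form (h x)"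
    and x0: "x0 \<in> S" and X: "\<And>x w. x \<in> S \<Longrightarrow> h x (X x) w = l \<bullet> w"
  obtains r L where "0 < r" "L-lipschitz_on (cball x0 r \<inter> S) X"
proof -
  have bil: "bilinear (h x)" if "x \<in> S" for x using lor[OF that] by (simp add: lorentzian_form_def)
  obtain r D where r: "0 < r" "0 < D"
    "\<And>x y u w. x \<in> cball x0 r \<inter> S \<Longrightarrow> y \<in> cball x0 r \<inter> S \<Longrightarrow>
       \<bar>h x u w - h y u w\<bar> \<le> D * norm (x - y) * norm u * norm w"
    by (rule smooth_bilinear_locally_lipschitz[OF sm bil x0]) blast+
  obtain G where linG: "linear G" "inj G" and G: "\<And>u w. G u \<bullet> w = h x0 u w"
    by (rule lorentzian_form_matrix[OF lor[OF x0]]) blast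
  obtain m where m: "0 < m" "\<And>u. m * norm u \<le> norm (G u)"
    using linear_inj_bounded_below_pos[OF linG] by blast
  \<comment> \<open>Within \<open>r'\<close> the form changes, relative to the norms of its
    arguments, by at most half of \<open>m\<close>, the lower bound for its matrix at
    \<open>x0\<close>.\<close>
  define r' where "r' = min r (m / (2 * D))"
  have r': "0 < r'" "r' \<le> r" "D * r' \<le> m / 2" using r(1,2) m(1) by (auto simp: r'_def min_def field_simps)
  \<comment> \<open>\<open>G u\<close> is the test vector on which the pairing with \<open>u\<close>
    at \<open>x0\<close> is largest relative to the norm.\<close>
  have lower: "m / 2 * norm u * norm (G u) \<le> h x u (G u)" if x: "x \<in> cball x0 r' \<inter> S" for x u
  proof -
    have "\<bar>h x u (G u) - h x0 u (G u)\<bar> \<le> D * norm (x - x0) * norm u * norm (G u)"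
      by (rule r(3)) (use x r' r(1) x0 in auto)
    also have "\<dots> \<le> m / 2 * norm u * norm (G u)"
    proof (intro mult_right_mono)
      have "D * norm (x - x0) \<le> D * r'"
        using x r(2) by (intro mult_left_mono) (auto simp: dist_norm norm_minus_commute)
      then show "D * norm (x - x0) \<le> m / 2" using r'(3) by linarith
    qed auto
    finally have 1: "h x0 u (G u) - m / 2 * norm u * norm (G u) \<le> h x u (G u)" by linarith
    have "h x0 u (G u) = norm (G u) * norm (G u)"
      using G[of u "G u"] by (simp add: dot_square_norm power2_eq_square)
    moreover have "m * norm u * norm (G u) \<le> norm (G u) * norm (G u)"
      using m(2) by (intro mult_right_mono) auto
    ultimately show ?thesis using 1 by simp
  qed
  \<comment> \<open>Bounds a vector by its pairings, uniformly in \<open>x\<close>. It is used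
    twice: for \<open>X x\<close> itself and for the difference of two values of
    \<open>X\<close>.\<close>
  have key: "norm u \<le> 2 * C / m"
    if x: "x \<in> cball x0 r' \<inter> S" and C: "\<And>w. h x u w \<le> C * norm w" "0 \<le> C" for x u C
  proof (cases "u = 0")
    case True then show ?thesis using C m by simp
  next
    case False
    then have "0 < norm (G u)" using m(1) m(2)[of u] by (smt (verit) mult_pos_pos zero_less_norm_iff)
    moreover have "m / 2 * norm u * norm (G u) \<le> C * norm (G u)"
      using lower[OF x, of u] C(1)[of "G u"] by linarith
    ultimately have "m / 2 * norm u \<le> C" by simp
    then show ?thesis using m(1) by (simp add: field_simps)
  qed
  define M where "M = 2 * norm l / m"
  have bound: "norm (X x) \<le> M" if x: "x \<in> cball x0 r' \<inter> S" for x
    unfolding M_def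
  proof (rule key[OF x])
    fix w
    have "h x (X x) w = l \<bullet> w" using X x by blast
    then show "h x (X x) w \<le> norm l * norm w" using norm_cauchy_schwarz by metis
  qed simp
  have "(2 * (D * M) / m)-lipschitz_on (cball x0 r' \<inter> S) X"
  proof (rule lipschitz_onI)
    fix x y assume x: "x \<in> cball x0 r' \<inter> S" and y: "y \<in> cball x0 r' \<inter> S"
    have "norm (X x - X y) \<le> 2 * (D * M * norm (x - y)) / m"
    proof (rule key[OF x])
      fix w
      \<comment> \<open>Both gradients represent the same \<open>l\<close> at their own points, so
        only the variation of the form, evaluated at \<open>X y\<close>, remains.\<close>
      have "h x (X x - X y) w = h y (X y) w - h x (X y) w"
        using X x y by (simp add: bilinear_lsub[OF bil])
      also have "\<dots> \<le> D * norm (y - x) * norm (X y) * norm w"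
      proof -
        have "\<bar>h y (X y) w - h x (X y) w\<bar> \<le> D * norm (y - x) * norm (X y) * norm w"
          by (rule r(3)) (use x y r'(2) in auto)
        then show ?thesis by linarith
      qed
      also have "\<dots> \<le> D * norm (y - x) * M * norm w"
        using bound[OF y] r(2) by (intro mult_right_mono mult_left_mono) auto
      finally show "h x (X x - X y) w \<le> D * M * norm (x - y) * norm w"
        by (simp add: mult_ac norm_minus_commute)
    qed (use r(2) m(1) in \<open>simp add: M_def\<close>)
    then show "dist (X x) (X y) \<le> 2 * (D * M) / m * dist x y" by (simp add: dist_norm)
  qed (use r(2) m(1) in \<open>simp add: M_def\<close>)
  then show thesis using r'(1) that by blast
qed

section \<open>Curves in one chart and chronological futures of points\<close>

lemma curve_in_chart:
  fixes A :: "('a::{t2_space, second_countable_topology}, 'e::euclidean_space \<times> real) chart set"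
  assumes A: "smooth_manifold A" and c: "c \<in> A" and P: "transition_invariant A P" and "a < b"
    and x: "x ` {a..b} \<subseteq> cimage c" and v: "continuous_on {a..b} v"
    and deriv: "\<And>t. t \<in> {a..b} \<Longrightarrow> (x has_vector_derivative v t) (at t within {a..b})"
    and Pv: "\<And>t. t \<in> {a..b} \<Longrightarrow> P c (cinv c (x t)) (v t)"
    and S: "\<And>t. t \<in> {a..b} \<Longrightarrow> cinv c (x t) \<in> S"
  shows "curve_in A P S (\<lambda>t. cinv c (x t)) a b"
proof (rule curve_in_C1_piece[OF C1_piece_chart[OF A c P \<open>a < b\<close> x v deriv Pv] \<open>a < b\<close>])
  have "continuous_on {a..b} x"
    unfolding continuous_on_eq_continuous_within
    using deriv[THEN has_vector_derivative_continuous] by blast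
  then show "continuous_on {a..b} (\<lambda>t. cinv c (x t))"
    by (rule continuous_on_compose2[OF is_chart_continuous_cinv[OF smooth_manifoldD(1)[OF A c]] _ x])
qed (use S in auto)

lemma lorentzian_metricD:
  assumes "lorentzian_metric A g"
  shows "bilinear_field_on A g" "c \<in> A \<Longrightarrow> p \<in> cdom c \<Longrightarrow> lorentzian_form (g c p)"
    "c \<in> A \<Longrightarrow> smooth_on (cimage c) (\<lambda>x. g c (cinv c x) u v)"
  using assms unfolding lorentzian_metric_def by blast+

lemma time_orientationD:
  assumes "time_orientation A g T"
  shows "vector_field_on A T" "c \<in> A \<Longrightarrow> continuous_on (cdom c) (T c)"
    "c \<in> A \<Longrightarrow> p \<in> cdom c \<Longrightarrow> g c p (T c p) (T c p) < 0"
  using assms unfolding time_orientation_def by blast+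

lemma continuous_on_bilinear_field:
  fixes h :: "'b::topological_space \<Rightarrow> 'c::euclidean_space \<Rightarrow> 'c \<Rightarrow> real"
  assumes h: "\<And>u w. continuous_on S (\<lambda>x. h x u w)" and bil: "\<And>x. x \<in> S \<Longrightarrow> bilinear (h x)"
    and x: "continuous_on Z x" "x ` Z \<subseteq> S" and u: "continuous_on Z u" and w: "continuous_on Z w"
  shows "continuous_on Z (\<lambda>z. h (x z) (u z) (w z))"
proof -
  have "continuous_on Z (\<lambda>z. \<Sum>i\<in>Basis. \<Sum>j\<in>Basis. (u z \<bullet> i) * (w z \<bullet> j) * h (x z) i j)"
    by (intro continuous_on_sum continuous_on_mult continuous_on_inner u w continuous_on_const
        continuous_on_compose2[OF h x])
  then show ?thesis
  proof (rule continuous_on_eq)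
    fix z assume "z \<in> Z"
    then have "x z \<in> S" using x(2) by blast
    from bilinear_expand_Basis[OF bil[OF this], symmetric]
    show "(\<Sum>i\<in>Basis. \<Sum>j\<in>Basis. (u z \<bullet> i) * (w z \<bullet> j) * h (x z) i j) = h (x z) (u z) (w z)" .
  qed
qed

lemma continuous_on_metric_coord:
  fixes A :: "('a::{t2_space, second_countable_topology}, 'e::euclidean_space \<times> real) chart set"
  assumes A: "smooth_manifold A" and g: "lorentzian_metric A g" and c: "c \<in> A"
    and x: "continuous_on Z x" "x ` Z \<subseteq> cimage c" and u: "continuous_on Z u" and w: "continuous_on Z w"
  shows "continuous_on Z (\<lambda>z. g c (cinv c (x z)) (u z) (w z))"
proof (rule continuous_on_bilinear_field[where h = "\<lambda>x. g c (cinv c x)", OF _ _ x u w])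
  fix u w show "continuous_on (cimage c) (\<lambda>x. g c (cinv c x) u w)"
    by (rule smooth_on_imp_continuous_on[OF lorentzian_metricD(3)[OF g c]])
next
  fix x assume "x \<in> cimage c"
  then have "cinv c x \<in> cdom c" by (rule is_chart_cinv(1)[OF smooth_manifoldD(1)[OF A c]])
  then show "bilinear (g c (cinv c x))"
    using lorentzian_metricD(2)[OF g c] by (simp add: lorentzian_form_def)
qed

lemma open_cdom_vimage:
  assumes "is_chart c" "open U"
  shows "open {q \<in> cdom c. cmap c q \<in> U}"
proof -
  have "continuous_on (cdom c) (cmap c)" "open (cdom c)"
    using assms(1) by (simp_all add: is_chart_def homeomorphism_def)
  from continuous_open_preimage[OF this assms(2)] show ?thesis
    by (rule back_subst[of "open"]) blast
qed

text \<open>The point \<open>q\<close> lies slightly to the past of \<open>p\<close> along \<open>T\<close>, and the curves are coordinate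
  straight lines.\<close>

lemma timelike_predecessor:
  fixes A :: "('a::{t2_space, second_countable_topology}, 'e::euclidean_space \<times> real) chart set"
  assumes A: "smooth_manifold A" and g: "lorentzian_metric A g" and T: "time_orientation A g T"
    and c: "c \<in> A" and p: "p \<in> cdom c" and op: "open (cimage c)"
  obtains q V where "open V" "p \<in> V"
    "\<And>y. y \<in> V \<Longrightarrow> \<exists>\<gamma> a b. curve_in A (future_timelike g T) (cdom c) \<gamma> a b \<and> \<gamma> a = q \<and> \<gamma> b = y"
proof -
  have ch: "is_chart c" by (rule smooth_manifoldD(1)[OF A c])
  define x0 where "x0 = cmap c p"
  define T0 where "T0 = T c p"
  have x0: "x0 \<in> cimage c" "cinv c x0 = p" using is_chart_cmap[OF ch p] by (auto simp: x0_def)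
  let ?Z = "cimage c \<times> (UNIV :: ('e \<times> real) set)"
  let ?Q = "\<lambda>z. g c (cinv c (fst z)) (snd z) (snd z)"
  let ?R = "\<lambda>z. g c (cinv c (fst z)) (T c (cinv c (fst z))) (snd z)"
  have fstZ: "continuous_on ?Z fst" "fst ` ?Z \<subseteq> cimage c" "continuous_on ?Z snd"
    by (auto intro: continuous_on_fst continuous_on_snd)
  have "continuous_on (cimage c) (\<lambda>x. T c (cinv c x))"
    by (rule continuous_on_compose2[OF time_orientationD(2)[OF T c] is_chart_continuous_cinv[OF ch]])
      (use is_chart_cinv(1)[OF ch] in blast)
  from continuous_on_compose2[OF this fstZ(1,2)]
  have contT: "continuous_on ?Z (\<lambda>z. T c (cinv c (fst z)))" .
  \<comment> \<open>Since the chart image is open in the full space, the boundary obstructs no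
    direction of motion, and the pairs of a point and a future timelike vector form an open
    set.\<close>
  have openZ: "open ?Z" using op by (intro open_Times open_UNIV)
  have Q: "open (?Z \<inter> ?Q -` {..<0})"
    by (rule continuous_open_preimage[OF continuous_on_metric_coord[OF A g c fstZ(1,2,3,3)] openZ]) auto
  have R: "open (?Z \<inter> ?R -` {..<0})"
    by (rule continuous_open_preimage[OF continuous_on_metric_coord[OF A g c fstZ(1,2) contT fstZ(3)] openZ]) auto
  have "(x0, T0) \<in> (?Z \<inter> ?Q -` {..<0}) \<inter> (?Z \<inter> ?R -` {..<0})"
    using time_orientationD(3)[OF T c p] x0 by (simp add: T0_def)
  then obtain U1 U2 where U: "open U1" "open U2" "(x0, T0) \<in> U1 \<times> U2"
    "U1 \<times> U2 \<subseteq> (?Z \<inter> ?Q -` {..<0}) \<inter> (?Z \<inter> ?R -` {..<0})"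
    by (rule open_prod_elim[OF open_Int[OF Q R]])
  have U12: "x \<in> cimage c \<and> future_timelike g T c (cinv c x) u" if "x \<in> U1" "u \<in> U2" for x u
  proof -
    have "(x, u) \<in> (?Z \<inter> ?Q -` {..<0}) \<inter> (?Z \<inter> ?R -` {..<0})" using U(4) that by blast
    then show ?thesis by (simp add: future_timelike_def)
  qed
  obtain r where r: "0 < r" "ball x0 r \<subseteq> U1" using U(1,3) open_contains_ball by blast
  obtain s where s: "0 < s" "ball T0 s \<subseteq> U2" using U(2,3) open_contains_ball by blast
  \<comment> \<open>Puts the starting point \<open>x1\<close> at distance at most
    \<open>r / 2\<close> from \<open>x0\<close>; the summand 1 spares a proof that \<open>T0\<close>
    is nonzero.\<close>
  define \<epsilon> where "\<epsilon> = r / (2 * (norm T0 + 1))"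
  have nT: "0 < norm T0 + 1" by (smt (verit) norm_ge_zero)
  have \<epsilon>: "0 < \<epsilon>" using r(1) nT by (simp add: \<epsilon>_def)
  have "\<epsilon> * norm T0 \<le> \<epsilon> * (norm T0 + 1)" using \<epsilon> by simp
  also have "\<dots> = r / 2"
  proof -
    have "r / (2 * n) * n = r / 2" if "0 < n" for n :: real using that by simp
    from this[OF nT] show ?thesis by (simp only: \<epsilon>_def)
  qed
  finally have \<epsilon>T: "\<epsilon> * norm T0 < r" using r(1) by simp
  define x1 where "x1 = x0 - \<epsilon> *\<^sub>R T0"
  have x1: "x1 \<in> ball x0 r" using \<epsilon>T \<epsilon> by (simp add: x1_def dist_norm)
  \<comment> \<open>The bound \<open>\<epsilon> * s\<close> keeps the velocity of the line from
    \<open>x1\<close> to the end point, run in time \<open>\<epsilon>\<close>, within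
    \<open>s\<close> of \<open>T0\<close>; the bound \<open>r\<close> keeps the line in the convex
    ball.\<close>
  define V where "V = {y \<in> cdom c. cmap c y \<in> ball x0 (min r (\<epsilon> * s))}"
  have "open V" unfolding V_def by (rule open_cdom_vimage[OF ch open_ball])
  moreover have "p \<in> V" using p r(1) s(1) \<epsilon> by (simp add: V_def x0_def)
  moreover have "\<exists>\<gamma> a b. curve_in A (future_timelike g T) (cdom c) \<gamma> a b \<and> \<gamma> a = cinv c x1 \<and> \<gamma> b = y"
    if y: "y \<in> V" for y
  proof -
    define z where "z = cmap c y"
    have z: "z \<in> ball x0 r" "norm (z - x0) < \<epsilon> * s" "cinv c z = y"
      using y is_chart_cmap(2)[OF ch] by (auto simp: V_def z_def dist_norm norm_minus_commute)
    define u where "u = (1 / \<epsilon>) *\<^sub>R (z - x1)"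
    have "u - T0 = (1 / \<epsilon>) *\<^sub>R (z - x0)" using \<epsilon> by (simp add: u_def x1_def algebra_simps)
    then have "norm (u - T0) = norm (z - x0) / \<epsilon>" using \<epsilon> by simp
    also have "\<dots> < s" using z(2) \<epsilon> by (simp add: field_simps)
    finally have u: "u \<in> U2" using s(2) by (auto simp: dist_norm norm_minus_commute)
    define x where "x t = x1 + t *\<^sub>R u" for t
    have x_in: "x t \<in> U1" if t: "t \<in> {0..\<epsilon>}" for t
    proof -
      have "x t = (1 - t / \<epsilon>) *\<^sub>R x1 + (t / \<epsilon>) *\<^sub>R z" by (simp add: x_def u_def algebra_simps)
      also have "\<dots> \<in> ball x0 r"
        by (rule convexD[OF convex_ball x1 z(1)]) (use t \<epsilon> in auto)
      finally show ?thesis using r(2) by blast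
    qed
    have "curve_in A (future_timelike g T) (cdom c) (\<lambda>t. cinv c (x t)) 0 \<epsilon>"
    proof (rule curve_in_chart[OF A c _ \<epsilon>, where v = "\<lambda>_. u"])
      show "transition_invariant A (future_timelike g T)"
        by (rule transition_invariant_future_timelike[OF lorentzian_metricD(1)[OF g] time_orientationD(1)[OF T]])
      show "x ` {0..\<epsilon>} \<subseteq> cimage c" using U12[OF x_in u] by blast
      show "(x has_vector_derivative u) (at t within {0..\<epsilon>})" for t
        unfolding x_def by (auto intro!: derivative_eq_intros)
      show "future_timelike g T c (cinv c (x t)) u" if "t \<in> {0..\<epsilon>}" for t
        using U12[OF x_in[OF that] u] by simp
      show "cinv c (x t) \<in> cdom c" if "t \<in> {0..\<epsilon>}" for t
        using U12[OF x_in[OF that] u] is_chart_cinv(1)[OF ch] by simp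
    qed simp
    moreover have "cinv c (x 0) = cinv c x1" "cinv c (x \<epsilon>) = y"
      using z(3) \<epsilon> by (simp_all add: x_def u_def)
    ultimately show ?thesis by (intro exI[of _ "\<lambda>t. cinv c (x t)"] exI[of _ 0] exI[of _ \<epsilon>]) simp
  qed
  ultimately show thesis using that by blast
qed

section \<open>Tangent vectors and the normal of a null hypersurface\<close>

text \<open>The transformation laws speak only of derivatives that exist. A local smooth extension
  of the transition map supplies one, at boundary points too.\<close>

lemma transition_derivative_exists:
  fixes A :: "('a::{t2_space, second_countable_topology}, 'e::euclidean_space \<times> real) chart set"
  assumes A: "smooth_manifold A" and "c \<in> A" "d \<in> A" and q: "q \<in> cdom c \<inter> cdom d"
  obtains L where "transition_derivative c d q L"
proof -
  have "smooth_on (overlap c d) (transition c d)"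
    using smooth_manifoldD(2)[OF assms(1-3)] by (simp add: compatible_def)
  moreover have q': "cmap c q \<in> overlap c d" using q by (simp add: overlap_def)
  ultimately obtain W F where W: "open W" "cmap c q \<in> W" "\<forall>k. Ck_on k W F"
    "\<forall>y\<in>W \<inter> overlap c d. F y = transition c d y" unfolding smooth_on_def by meson
  have "(F has_derivative frechet_derivative F (at (cmap c q))) (at (cmap c q))"
    by (rule Ck_on_Suc_0_has_derivative[OF W(3)[rule_format] W(2)])
  note F = has_derivative_at_withinI[OF this]
  obtain r where r: "0 < r" "ball (cmap c q) r \<subseteq> W" using W(1,2) open_contains_ball by blast
  have "(transition c d has_derivative frechet_derivative F (at (cmap c q))) (at (cmap c q) within overlap c d)"
    by (rule has_derivative_transform_within[OF F r(1) q'])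
      (use r(2) W(4) in \<open>simp add: subset_eq dist_commute\<close>)
  then show thesis using that by (simp add: transition_derivative_def)
qed

lemma openin_overlap:
  fixes c d :: "('a::topological_space, 'e::euclidean_space \<times> real) chart"
  assumes "is_chart c" "is_chart d"
  shows "openin (top_of_set half_space) (overlap c d)"
proof -
  have "overlap c d = cimage c \<inter> cinv c -` cdom d"
  proof (intro set_eqI iffI)
    fix x assume "x \<in> overlap c d"
    then obtain q where q: "q \<in> cdom c" "q \<in> cdom d" "x = cmap c q" by (auto simp: overlap_def)
    then show "x \<in> cimage c \<inter> cinv c -` cdom d" using is_chart_cmap[OF assms(1) q(1)] by simp
  next
    fix x assume x: "x \<in> cimage c \<inter> cinv c -` cdom d"
    then show "x \<in> overlap c d"
      unfolding overlap_def using is_chart_cinv[OF assms(1), of x]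
      by (intro image_eqI[of _ _ "cinv c x"]) simp_all
  qed
  moreover have "openin (top_of_set (cimage c)) (cimage c \<inter> cinv c -` cdom d)"
    using assms by (intro continuous_openin_preimage_gen is_chart_continuous_cinv) (simp_all add: is_chart_def)
  ultimately show ?thesis using assms(1) openin_trans by (metis is_chart_def)
qed

text \<open>Move along a straight line in the level of \<open>c\<close> that represents
  \<open>N\<close>. It stays in \<open>N\<close>, so the last coordinate of \<open>d\<close> is
  constant along it, and the chain rule applies.\<close>

lemma transition_derivative_tangent:
  fixes A :: "('a::{t2_space, second_countable_topology}, 'e::euclidean_space \<times> real) chart set"
  assumes A: "smooth_manifold A" and c: "c \<in> A" and d: "d \<in> A" and q: "q \<in> cdom c \<inter> cdom d"
    and L: "transition_derivative c d q L"
    and Nc: "N \<inter> cdom c = {z \<in> cdom c. snd (cmap c z) = snd (cmap c q)}"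
    and Nd: "N \<inter> cdom d = {z \<in> cdom d. snd (cmap d z) = snd (cmap d q)}"
    and w: "snd w = 0"
  shows "snd (L w) = 0"
proof -
  have ch: "is_chart c" "is_chart d" using smooth_manifoldD(1)[OF A] c d by blast+
  obtain U where U: "open U" "overlap c d = half_space \<inter> U"
    using openin_overlap[OF ch] unfolding openin_open by blast
  define x0 where "x0 = cmap c q"
  have x0: "x0 \<in> overlap c d" using q by (simp add: overlap_def x0_def)
  define \<phi> where "\<phi> t = x0 + t *\<^sub>R w" for t
  \<comment> \<open>A line parallel to the edge of the half-space never leaves it, so the derivative
    at 0 is two-sided even for boundary points.\<close>
  have \<phi>_half: "\<phi> t \<in> half_space" for t using x0 U(2) w by (simp add: \<phi>_def half_space_def)
  define S where "S = \<phi> -` U"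
  have "continuous_on UNIV \<phi>" unfolding \<phi>_def by (intro continuous_intros)
  then have S: "open S" "0 \<in> S"
    using U x0 by (auto simp: S_def \<phi>_def open_vimage)
  have \<phi>S: "\<phi> t \<in> overlap c d" if "t \<in> S" for t using U(2) \<phi>_half that by (simp add: S_def)
  have const: "snd (transition c d (\<phi> t)) = snd (cmap d q)" if "t \<in> S" for t
  proof -
    from \<phi>S[OF that] obtain z where z: "z \<in> cdom c" "z \<in> cdom d" "\<phi> t = cmap c z"
      unfolding overlap_def by auto
    have "snd (cmap c z) = snd (cmap c q)" using z(3) w by (simp add: \<phi>_def x0_def[symmetric])
      (metis add.right_neutral mult_zero_right real_scaleR_def snd_add snd_scaleR)
    then have "z \<in> N" using Nc z(1) by blast
    then have "snd (cmap d z) = snd (cmap d q)" using Nd z(2) by blast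
    then show ?thesis using z(3) is_chart_cmap(2)[OF ch(1) z(1)] by (simp add: transition_def)
  qed
  have \<phi>0: "\<phi> 0 = cmap c q" by (simp add: \<phi>_def x0_def)
  have \<phi>': "(\<phi> has_derivative (\<lambda>t. t *\<^sub>R w)) (at 0 within S)"
    unfolding \<phi>_def by (auto intro!: derivative_eq_intros)
  have "(transition c d has_derivative L) (at (\<phi> 0) within \<phi> ` S)"
    unfolding \<phi>0 using L unfolding transition_derivative_def
    by (rule has_derivative_subset) (use \<phi>S in blast)
  from diff_chain_within[OF \<phi>' this]
  have "((\<lambda>t. transition c d (\<phi> t)) has_derivative (\<lambda>t. L (t *\<^sub>R w))) (at 0 within S)"
    unfolding o_def .
  from has_derivative_snd[OF this]
  have "((\<lambda>t. snd (transition c d (\<phi> t))) has_derivative (\<lambda>t. snd (L (t *\<^sub>R w)))) (at 0)"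
    unfolding at_within_open[OF S(2,1)] .
  moreover have "((\<lambda>t. snd (transition c d (\<phi> t))) has_derivative (\<lambda>t. 0)) (at 0)"
    by (rule has_derivative_transform_within_open[OF has_derivative_const S(1,2)]) (simp add: const)
  ultimately have "(\<lambda>t. snd (L (t *\<^sub>R w))) = (\<lambda>t. 0)" by (rule has_derivative_unique)
  from fun_cong[OF this, of 1] show ?thesis by simp
qed

text \<open>\<open>X\<close> is the gradient of the last coordinate of \<open>c\<close>, thus normal
  to \<open>N\<close>. The degenerate direction \<open>v\<close>, carried over from
  \<open>d\<close>, is normal as well, hence a nonzero multiple of \<open>X\<close>; being tangent,
  it makes \<open>X\<close> tangent. Two charts occur because nullity at \<open>q\<close> is
  witnessed in a chart that depends on \<open>q\<close>.\<close>

lemma snd_gradient_tangent: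
  fixes A :: "('a::{t2_space, second_countable_topology}, 'e::euclidean_space \<times> real) chart set"
  assumes A: "smooth_manifold A" and g: "lorentzian_metric A g"
    and c: "c \<in> A" and d: "d \<in> A" and q: "q \<in> cdom c \<inter> cdom d"
    and Nc: "N \<inter> cdom c = {z \<in> cdom c. snd (cmap c z) = snd (cmap c q)}"
    and Nd: "N \<inter> cdom d = {z \<in> cdom d. snd (cmap d z) = snd (cmap d q)}"
    and v: "v \<noteq> 0" "snd v = 0" "\<And>w. snd w = 0 \<Longrightarrow> g d q v w = 0"
    and X: "\<And>w. g c q X w = snd w"
  shows "snd X = 0"
proof -
  obtain L where L: "transition_derivative c d q L"
    by (rule transition_derivative_exists[OF A c d q]) blast
  have lor: "lorentzian_form (g c q)" "lorentzian_form (g d q)"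
    using lorentzian_metricD(2)[OF g] c d q by blast+
  have bil: "bilinear (g c q)" "bilinear (g d q)" using lor by (simp_all add: lorentzian_form_def)
  have iso: "g d q (L u) (L w) = g c q u w" for u w
    using lorentzian_metricD(1)[OF g] c d q L unfolding bilinear_field_on_def by blast
  have lin: "linear L"
    using L unfolding transition_derivative_def by (rule has_derivative_linear)
  have "inj L"
    unfolding linear_injective_0[OF lin]
  proof (intro allI impI)
    fix u assume "L u = 0"
    then have "g c q u w = 0" for w using iso[of u w] bilinear_lzero[OF bil(2)] by simp
    then show "u = 0" by (rule lorentzian_form_nondegenerate[OF lor(1)])
  qed
  then have "surj L" using linear_injective_imp_surjective[OF lin] by blast
  then obtain u where u: "v = L u" by (rule surjE)
  have tangent: "g c q u w = 0" if "snd w = 0" for w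
    using v(3)[OF transition_derivative_tangent[OF A c d q L Nc Nd that]] iso[of u w] u by simp
  define l where "l = g c q u (0, 1)"
  have ul: "g c q u w = l * snd w" for w
  proof -
    have "w = (fst w, 0) + snd w *\<^sub>R (0, 1)" by (simp add: prod_eq_iff)
    then have "g c q u w = g c q u (fst w, 0) + snd w * g c q u (0, 1)"
      using bilinear_radd[OF bil(1)] bilinear_rmul[OF bil(1)] by (metis real_scaleR_def)
    then show ?thesis using tangent[of "(fst w, 0)"] by (simp add: l_def)
  qed
  have "u - l *\<^sub>R X = 0"
  proof (rule lorentzian_form_nondegenerate[OF lor(1)])
    fix w show "g c q (u - l *\<^sub>R X) w = 0"
      by (simp add: bilinear_lsub[OF bil(1)] bilinear_lmul[OF bil(1)] ul X)
  qed
  then have u_X: "u = l *\<^sub>R X" by simp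
  have "u \<noteq> 0" using u v(1) linear_0[OF lin] by auto
  then have "l \<noteq> 0" using u_X by auto
  \<comment> \<open>\<open>v\<close> is both tangent and normal, hence null, and so is its
    counterpart \<open>u\<close>; but \<open>g c q u u\<close> equals
    \<open>l * snd u\<close>.\<close>
  have "l * snd u = 0" using ul[of u] iso[of u u] v(3)[OF v(2)] u by simp
  then show ?thesis using u_X \<open>l \<noteq> 0\<close> by simp
qed

text \<open>In a chart adapted to \<open>N\<close> at \<open>p\<close>, the gradient of the last
  coordinate is, up to sign, a future null field tangent to the level \<open>s0\<close>. Applied to
  the remaining coordinates, \<open>flow_into_ball\<close> yields generator segments that start
  outside \<open>W\<close> and end at any prescribed point of \<open>N\<close> in
  \<open>W\<close>.\<close>

lemma null_generator_leaves:
  fixes A :: "('a::{t2_space, second_countable_topology}, 'e::euclidean_space \<times> real) chart set"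
  assumes A: "smooth_manifold A" and g: "lorentzian_metric A g" and T: "time_orientation A g T"
    and N: "null_hypersurface A g N" and p: "p \<in> N"
  obtains W where "open W" "p \<in> W"
    "\<And>r. r \<in> N \<inter> W \<Longrightarrow> \<exists>\<gamma> a b. curve_in A (future_causal g T) N \<gamma> a b \<and> \<gamma> a \<notin> W \<and> \<gamma> b = r"
proof -
  have null: "\<exists>d\<in>A. q \<in> cdom d \<and> N \<inter> cdom d = {z \<in> cdom d. snd (cmap d z) = snd (cmap d q)} \<and>
        (\<exists>v. v \<noteq> 0 \<and> snd v = 0 \<and> (\<forall>w. snd w = 0 \<longrightarrow> g d q v w = 0))" if "q \<in> N" for q
    using N that unfolding null_hypersurface_def by (rule bspec)
  from null[OF p] obtain c where c: "c \<in> A" and pc: "p \<in> cdom c"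
    and Nc: "N \<inter> cdom c = {z \<in> cdom c. snd (cmap c z) = snd (cmap c p)}" by blast
  have ch: "is_chart c" by (rule smooth_manifoldD(1)[OF A c])
  define x0 where "x0 = cmap c p"
  define y0 where "y0 = fst x0"
  define s0 where "s0 = snd x0"
  have x0: "x0 \<in> cimage c" "cinv c x0 = p" "x0 = (y0, s0)"
    using is_chart_cmap[OF ch pc] by (auto simp: x0_def y0_def s0_def)
  let ?h = "\<lambda>x. g c (cinv c x)"
  have lor: "lorentzian_form (?h x)" if "x \<in> cimage c" for x
    by (rule lorentzian_metricD(2)[OF g c is_chart_cinv(1)[OF ch that]])
  have "\<forall>x\<in>cimage c. \<exists>X. \<forall>w. ?h x X w = (0, 1) \<bullet> w"
    using lorentzian_form_represents[OF lor] by metis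
  from bchoice[OF this] obtain X where X': "\<forall>x\<in>cimage c. \<forall>w. ?h x (X x) w = (0, 1) \<bullet> w" by blast
  have X: "?h x (X x) w = snd w" if "x \<in> cimage c" for x w
    using bspec[OF X' that, THEN spec, of w] by (simp add: inner_prod_def)
  have X_nz: "X x \<noteq> 0" if "x \<in> cimage c" for x
  proof
    assume "X x = 0"
    then have "?h x 0 (0, 1) = 1" using X[OF that, of "(0, 1)"] by simp
    moreover have "bilinear (?h x)" using lor[OF that] by (simp add: lorentzian_form_def)
    ultimately show False by (simp add: bilinear_lzero)
  qed
  have in_N: "cinv c x \<in> N" if "x \<in> cimage c" "snd x = s0" for x
  proof -
    have "cinv c x \<in> {z \<in> cdom c. snd (cmap c z) = snd (cmap c p)}"
      using is_chart_cinv[OF ch that(1)] that(2) by (simp add: s0_def x0_def)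
    then show ?thesis unfolding Nc[symmetric] by blast
  qed
  have X_tangent: "snd (X x) = 0" if x: "x \<in> cimage c" "snd x = s0" for x
  proof -
    define q where "q = cinv c x"
    have q: "q \<in> N" "q \<in> cdom c" "cmap c q = x"
      using in_N[OF x] is_chart_cinv[OF ch x(1)] by (simp_all add: q_def)
    from null[OF q(1)] obtain d v where d: "d \<in> A" "q \<in> cdom d"
      "N \<inter> cdom d = {z \<in> cdom d. snd (cmap d z) = snd (cmap d q)}"
      "v \<noteq> 0" "snd v = 0" "\<And>w. snd w = 0 \<Longrightarrow> g d q v w = 0" by blast
    have Nq: "N \<inter> cdom c = {z \<in> cdom c. snd (cmap c z) = snd (cmap c q)}"
      using Nc q(3) x(2) by (simp add: s0_def x0_def)
    have qcd: "q \<in> cdom c \<inter> cdom d" using q(2) d(2) by (rule IntI)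
    have Xq: "g c q (X x) w = snd w" for w using X[OF x(1), of w] by (simp add: q_def)
    show ?thesis by (rule snd_gradient_tangent[OF A g c d(1) qcd Nq d(3-6) Xq])
  qed
  obtain r L where r: "0 < r" and lip: "L-lipschitz_on (cball x0 r \<inter> cimage c) X"
    by (rule gradient_locally_lipschitz[of "cimage c" ?h x0 X "(0, 1)"])
      (use lorentzian_metricD(3)[OF g c] lor x0(1) X' in blast)+
  \<comment> \<open>By the defining property of the gradient, the pairing of \<open>T\<close> with
    \<open>X\<close> is the last component of \<open>T\<close>, so its continuity comes from
    \<open>T\<close> alone.\<close>
  define \<theta> where "\<theta> x = snd (T c (cinv c x))" for x
  have \<theta>: "?h x (T c (cinv c x)) (X x) = \<theta> x" if "x \<in> cimage c" for x
    using lor[OF that] X[OF that] by (metis \<theta>_def lorentzian_form_def)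
  have "continuous_on (cimage c) (\<lambda>x. T c (cinv c x))"
    by (rule continuous_on_compose2[OF time_orientationD(2)[OF T c] is_chart_continuous_cinv[OF ch]])
      (use is_chart_cinv(1)[OF ch] in blast)
  then have cont\<theta>: "continuous_on (cimage c) \<theta>" unfolding \<theta>_def by (rule continuous_on_snd)
  \<comment> \<open>A nonzero null vector is never orthogonal to the timelike \<open>T\<close>, so
    the sign of \<open>\<theta> x0\<close> decides the time direction of \<open>X\<close>.\<close>
  have "\<theta> x0 \<noteq> 0"
  proof -
    have "?h x0 (T c (cinv c x0)) (X x0) \<noteq> 0"
    proof (rule lorentzian_form_timelike_causal[OF lor[OF x0(1)] _ _ X_nz[OF x0(1)]])
      show "?h x0 (T c (cinv c x0)) (T c (cinv c x0)) < 0"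
        by (rule time_orientationD(3)[OF T c is_chart_cinv(1)[OF ch x0(1)]])
      show "?h x0 (X x0) (X x0) \<le> 0"
        using X[OF x0(1), of "X x0"] X_tangent[OF x0(1)] by (simp add: s0_def)
    qed
    then show ?thesis using \<theta>[OF x0(1)] by simp
  qed
  then obtain r2 where r2: "0 < r2" "\<And>x. x \<in> cimage c \<Longrightarrow> dist x x0 < r2 \<Longrightarrow> dist (\<theta> x) (\<theta> x0) < \<bar>\<theta> x0\<bar>"
    using cont\<theta>[unfolded continuous_on_iff, rule_format, OF x0(1), of "\<bar>\<theta> x0\<bar>"] by auto
  obtain U where U: "open U" "cimage c = half_space \<inter> U"
    using ch unfolding is_chart_def openin_open by blast
  have "x0 \<in> U" using x0(1) U(2) by blast
  then obtain r1 where r1: "0 < r1" "ball x0 r1 \<subseteq> U" using U(1) open_contains_ball by blast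
  define \<rho> where "\<rho> = min r (min r1 r2) / 2"
  have \<rho>: "0 < \<rho>" "\<rho> \<le> r" "\<rho> < r1" "\<rho> < r2" using r r1(1) r2(1) by (auto simp: \<rho>_def)
  have level: "(y, s0) \<in> cball x0 r \<inter> cimage c" "dist (y, s0) x0 < r2" if "y \<in> cball y0 \<rho>" for y
  proof -
    have d: "dist (y, s0) x0 = dist y y0" by (simp add: x0(3) dist_Pair_Pair)
    have "0 \<le> s0" using x0(1) U(2) by (simp add: half_space_def s0_def)
    then have "(y, s0) \<in> half_space" by (simp add: half_space_def)
    moreover have "(y, s0) \<in> U" using r1(2) \<rho>(3) that d by (auto simp: subset_eq dist_commute)
    ultimately show "(y, s0) \<in> cball x0 r \<inter> cimage c"
      using U(2) \<rho>(2) that d by (simp add: dist_commute)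
    show "dist (y, s0) x0 < r2" using \<rho>(4) that d by (simp add: dist_commute)
  qed
  \<comment> \<open>The sign that turns \<open>X\<close> to the future at \<open>x0\<close>; by the
    choice of \<open>r2\<close> it does so on the whole part of the level over the ball of radius
    \<open>\<rho>\<close>.\<close>
  define \<sigma> where "\<sigma> = - sgn (\<theta> x0)"
  have \<sigma>: "\<bar>\<sigma>\<bar> = 1" using \<open>\<theta> x0 \<noteq> 0\<close> by (simp add: \<sigma>_def abs_sgn_eq)
  have \<sigma>\<theta>: "\<sigma> * \<theta> (y, s0) < 0" if "y \<in> cball y0 \<rho>" for y
    using r2(2)[of "(y, s0)"] level[OF that] \<open>\<theta> x0 \<noteq> 0\<close>
    by (auto simp: \<sigma>_def sgn_if dist_real_def split: if_splits)
  define \<xi> where "\<xi> y = \<sigma> *\<^sub>R fst (X (y, s0))" for y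
  have "L-lipschitz_on (cball y0 \<rho>) \<xi>"
  proof (rule lipschitz_onI)
    fix y z assume yz: "y \<in> cball y0 \<rho>" "z \<in> cball y0 \<rho>"
    have "dist (\<xi> y) (\<xi> z) = dist (fst (X (y, s0))) (fst (X (z, s0)))"
      using \<sigma> by (simp add: \<xi>_def dist_norm scaleR_diff_right[symmetric])
    also have "\<dots> \<le> dist (X (y, s0)) (X (z, s0))" by (rule dist_fst_le)
    also have "\<dots> \<le> L * dist (y, s0) (z, s0)" by (rule lipschitz_onD[OF lip level(1)[OF yz(1)] level(1)[OF yz(2)]])
    finally show "dist (\<xi> y) (\<xi> z) \<le> L * dist y z" by (simp add: dist_Pair_Pair)
  qed (use lip lipschitz_on_nonneg in blast)
  moreover have "\<xi> y0 \<noteq> 0"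
    using X_nz[OF x0(1)] X_tangent[OF x0(1)] \<sigma> by (auto simp: \<xi>_def x0(3) prod_eq_iff)
  ultimately obtain h \<delta> where h: "0 < h" "0 < \<delta>"
    and flow: "\<And>y1. y1 \<in> ball y0 \<delta> \<Longrightarrow> \<exists>y. y h = y1 \<and> y 0 \<notin> ball y0 \<delta> \<and>
       (\<forall>t\<in>{0..h}. y t \<in> cball y0 \<rho> \<and> (y has_vector_derivative \<xi> (y t)) (at t within {0..h}))"
    and lip\<xi>: "L-lipschitz_on (cball y0 \<rho>) \<xi>"
    using flow_into_ball[OF _ \<rho>(1)] by metis
  \<comment> \<open>A cylinder: the points of \<open>N\<close> in this chart all have last
    coordinate \<open>s0\<close>, so only the other coordinates matter.\<close>
  define W where "W = {q \<in> cdom c. cmap c q \<in> ball y0 \<delta> \<times> UNIV}"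
  have "open W" unfolding W_def by (intro open_cdom_vimage[OF ch] open_Times) auto
  moreover have "p \<in> W" using pc h(2) by (simp add: W_def x0_def[symmetric] x0(3))
  moreover have "\<exists>\<gamma> a b. curve_in A (future_causal g T) N \<gamma> a b \<and> \<gamma> a \<notin> W \<and> \<gamma> b = r'"
    if r': "r' \<in> N \<inter> W" for r'
  proof -
    have r'c: "r' \<in> cdom c" "fst (cmap c r') \<in> ball y0 \<delta>" using r' by (auto simp: W_def mem_Times_iff)
    have "r' \<in> N \<inter> cdom c" using r' r'c(1) by blast
    then have "snd (cmap c r') = s0" unfolding Nc by (simp add: s0_def x0_def)
    then have r'_eq: "cinv c (fst (cmap c r'), s0) = r'"
      using is_chart_cmap(2)[OF ch r'c(1)] by (metis prod.collapse)
    from flow[OF r'c(2)] obtain y where y: "y h = fst (cmap c r')" "y 0 \<notin> ball y0 \<delta>"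
      and y_in: "\<And>t. t \<in> {0..h} \<Longrightarrow> y t \<in> cball y0 \<rho>"
      and y': "\<And>t. t \<in> {0..h} \<Longrightarrow> (y has_vector_derivative \<xi> (y t)) (at t within {0..h})" by blast
    have conty: "continuous_on {0..h} y"
      unfolding continuous_on_eq_continuous_within
      using y'[THEN has_vector_derivative_continuous] by blast
    have y_img: "(y t, s0) \<in> cimage c" if "t \<in> {0..h}" for t using level(1)[OF y_in[OF that]] by blast
    have "curve_in A (future_causal g T) N (\<lambda>t. cinv c (y t, s0)) 0 h"
    proof (rule curve_in_chart[OF A c _ h(1), where v = "\<lambda>t. (\<xi> (y t), 0)"])
      show "transition_invariant A (future_causal g T)"
        by (rule transition_invariant_future_causal[OF lorentzian_metricD(1)[OF g] time_orientationD(1)[OF T]])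
      show "(\<lambda>t. (y t, s0)) ` {0..h} \<subseteq> cimage c" using y_img by blast
      have "continuous_on {0..h} (\<lambda>t. \<xi> (y t))"
        by (rule continuous_on_compose2[OF lipschitz_on_continuous_on[OF lip\<xi>] conty]) (use y_in in blast)
      then show "continuous_on {0..h} (\<lambda>t. (\<xi> (y t), 0 :: real))" by (intro continuous_on_Pair continuous_on_const)
    next
      fix t assume t: "t \<in> {0..h}"
      show "((\<lambda>t. (y t, s0)) has_vector_derivative (\<xi> (y t), 0)) (at t within {0..h})"
        by (rule has_vector_derivative_Pair[OF y'[OF t] has_vector_derivative_const])
      show "cinv c (y t, s0) \<in> N" by (rule in_N[OF y_img[OF t]]) simp
      let ?x = "(y t, s0)"
      have v: "(\<xi> (y t), 0) = \<sigma> *\<^sub>R X ?x"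
        using X_tangent[OF y_img[OF t]] by (simp add: \<xi>_def prod_eq_iff)
      have bil: "bilinear (?h ?x)" using lor[OF y_img[OF t]] by (simp add: lorentzian_form_def)
      show "future_causal g T c (cinv c ?x) (\<xi> (y t), 0)"
        unfolding future_causal_def v
      proof (intro conjI)
        show "\<sigma> *\<^sub>R X ?x \<noteq> 0" using X_nz[OF y_img[OF t]] \<sigma> by auto
        show "?h ?x (\<sigma> *\<^sub>R X ?x) (\<sigma> *\<^sub>R X ?x) \<le> 0"
          using X[OF y_img[OF t]] X_tangent[OF y_img[OF t]]
          by (simp add: bilinear_lmul[OF bil] bilinear_rmul[OF bil])
        show "?h ?x (T c (cinv c ?x)) (\<sigma> *\<^sub>R X ?x) < 0"
          using \<theta>[OF y_img[OF t]] \<sigma>\<theta>[OF y_in[OF t]] by (simp add: bilinear_rmul[OF bil])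
      qed
    qed
    moreover have "cinv c (y 0, s0) \<notin> W"
      using y(2) is_chart_cinv(2)[OF ch y_img[of 0]] h(1) by (simp add: W_def)
    moreover have "cinv c (y h, s0) = r'" using r'_eq y(1) by simp
    ultimately show ?thesis by (intro exI[of _ "\<lambda>t. cinv c (y t, s0)"] exI[of _ 0] exI[of _ h] conjI)
  qed
  ultimately show thesis by (rule that)
qed

section \<open>Imprisonment\<close>

text \<open>The point supplied by \<open>leave\<close> lies in \<open>E\<close> again, so the step
  can be iterated. \<open>E\<close> carries the iteration and \<open>C\<close> only the compactness;
  thus \<open>E\<close> itself need not be closed.\<close>

lemma strongly_causal_leaving_sequence:
  assumes sc: "strongly_causal A g T S" and C: "compact C" "C \<subseteq> S" and E: "E \<subseteq> C" "p \<in> E"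
    and leave: "\<And>z. z \<in> C \<Longrightarrow> \<exists>W. open W \<and> z \<in> W \<and> (\<forall>r\<in>E \<inter> W. \<exists>\<gamma> a b.
      curve_in A (future_causal g T) S \<gamma> a b \<and> \<gamma> a \<in> E - W \<and> \<gamma> b = r)"
  shows False
proof -
  define R where "R z z' \<longleftrightarrow> (\<exists>\<gamma> a b. curve_in A (future_causal g T) S \<gamma> a b \<and> \<gamma> a = z \<and> \<gamma> b = z')" for z z'
  have R_trans: "R x z" if "R x y" "R y z" for x y z
    using that unfolding R_def by (metis curve_in_join)
  \<comment> \<open>Departures are from the larger neighbourhood \<open>W\<close>, returns are to
    the smaller \<open>V\<close>, which strong causality attaches to \<open>W\<close>.\<close>
  define good where "good z V W \<longleftrightarrow> open V \<and> z \<in> V \<and> V \<subseteq> W \<and>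
      (\<forall>r\<in>E \<inter> V. \<exists>r'\<in>E - W. R r' r) \<and>
      (\<forall>\<gamma> a b. curve_in A (future_causal g T) S \<gamma> a b \<and> \<gamma> a \<in> V \<and> \<gamma> b \<in> V \<longrightarrow> \<gamma> ` {a..b} \<subseteq> W)" for z V W
  have "\<exists>V W. good z V W" if z: "z \<in> C" for z
  proof -
    from leave[OF z] obtain W where W: "open W" "z \<in> W"
      and W_leave: "\<forall>r\<in>E \<inter> W. \<exists>\<gamma> a b.
        curve_in A (future_causal g T) S \<gamma> a b \<and> \<gamma> a \<in> E - W \<and> \<gamma> b = r" by blast
    have "z \<in> S" using z C(2) by blast
    from sc[unfolded strongly_causal_def, rule_format, OF this conjI[OF W]]
    obtain V where V: "open V" "z \<in> V" "V \<subseteq> W" "\<forall>\<gamma> a b. curve_in A (future_causal g T) S \<gamma> a b \<and> \<gamma> a \<in> V \<and> \<gamma> b \<in> V \<longrightarrow> \<gamma> ` {a..b} \<subseteq> W"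
      by blast
    have "\<exists>r'\<in>E - W. R r' r" if "r \<in> E \<inter> V" for r
      using W_leave that V(3) unfolding R_def by (metis IntD1 IntD2 IntI subsetD)
    then show ?thesis using V unfolding good_def by blast
  qed
  then obtain V W where good: "\<And>z. z \<in> C \<Longrightarrow> good z (V z) (W z)" by metis
  have VW: "z \<in> C \<Longrightarrow> open (V z)" "z \<in> C \<Longrightarrow> z \<in> V z" "z \<in> C \<Longrightarrow> V z \<subseteq> W z"
    "\<And>r. z \<in> C \<Longrightarrow> r \<in> E \<inter> V z \<Longrightarrow> \<exists>r'\<in>E - W z. R r' r"
    "\<And>\<gamma> a b. z \<in> C \<Longrightarrow> curve_in A (future_causal g T) S \<gamma> a b \<Longrightarrow> \<gamma> a \<in> V z \<Longrightarrow> \<gamma> b \<in> V z \<Longrightarrow> \<gamma> ` {a..b} \<subseteq> W z" for z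
    using good[of z] unfolding good_def by blast+
  obtain I where I: "I \<subseteq> C" "finite I" "C \<subseteq> (\<Union>i\<in>I. V i)"
    by (rule compactE_image[OF C(1), of C V]) (use VW(1,2) in auto)
  \<comment> \<open>Higher indices lie further in the past: a causal curve leads from
    \<open>q (Suc n)\<close> to \<open>q n\<close>.\<close>
  have "\<exists>q. \<forall>n. q n \<in> E \<and> (\<exists>i\<in>I. q n \<in> V i \<and> q (Suc n) \<notin> W i \<and> R (q (Suc n)) (q n))"
  proof (rule dependent_nat_choice[where P = "\<lambda>_ x. x \<in> E"
        and Q = "\<lambda>_ x y. \<exists>i\<in>I. x \<in> V i \<and> y \<notin> W i \<and> R y x"])
    show "\<exists>x. x \<in> E" using E(2) by blast
    fix x and n :: nat assume x: "x \<in> E"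
    then obtain i where i: "i \<in> I" "x \<in> V i" using I(3) E(1) by blast
    then have "i \<in> C" "x \<in> E \<inter> V i" using I(1) x by auto
    from VW(4)[OF this] obtain r' where "r' \<in> E - W i" "R r' x" by blast
    then show "\<exists>y. y \<in> E \<and> (\<exists>i\<in>I. x \<in> V i \<and> y \<notin> W i \<and> R y x)" using i by blast
  qed
  then obtain q where q: "\<forall>n. \<exists>i\<in>I. q n \<in> V i \<and> q (Suc n) \<notin> W i \<and> R (q (Suc n)) (q n)" by blast
  then obtain i where i: "\<And>n. i n \<in> I" "\<And>n. q n \<in> V (i n)" "\<And>n. q (Suc n) \<notin> W (i n)"
    and step: "\<And>n. R (q (Suc n)) (q n)" by metis
  have "finite (range i)" using I(2) i(1) by (meson finite_subset image_subsetI)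
  then have "\<not> inj i" using finite_imageD infinite_UNIV_nat by blast
  then obtain m n where mn: "m < n" "i m = i n" unfolding inj_def by (metis nat_neq_iff)
  have chain: "R (q (Suc m + Suc k)) (q (Suc m))" for k
  proof (induction k)
    case 0
    then show ?case using step[of "Suc m"] by simp
  next
    case (Suc k)
    then show ?case using R_trans[OF step[of "Suc m + Suc k"]] by simp
  qed
  have iC: "i m \<in> C" using i(1) I(1) by blast
  have qn: "q n \<in> V (i m)" using i(2)[of n] mn(2) by simp
  \<comment> \<open>Curves have nondegenerate parameter intervals, so \<open>R\<close> need not be
    reflexive, and the case that \<open>q n\<close> is the excursion point \<open>q (Suc m)\<close>
    has to be excluded separately.\<close>
  have "n \<noteq> Suc m" using qn i(3)[of m] VW(3)[OF iC] by blast
  then obtain k where "n = Suc m + Suc k" using mn(1) by (metis Suc_lessI add_Suc_right less_iff_Suc_add)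
  then have "R (q n) (q (Suc m))" using chain by simp
  then obtain \<gamma>1 a b where c1: "curve_in A (future_causal g T) S \<gamma>1 a b" "\<gamma>1 a = q n" "\<gamma>1 b = q (Suc m)"
    unfolding R_def by blast
  obtain \<gamma>2 a' b' where c2: "curve_in A (future_causal g T) S \<gamma>2 a' b'" "\<gamma>2 a' = q (Suc m)" "\<gamma>2 b' = q m"
    using step[of m] unfolding R_def by blast
  \<comment> \<open>This curve starts and ends in \<open>V (i m)\<close> but passes through
    \<open>q (Suc m)\<close>, which is outside \<open>W (i m)\<close>.\<close>
  obtain \<gamma> d where "curve_in A (future_causal g T) S \<gamma> a d" "\<gamma> a = q n" "\<gamma> d = q m" "q (Suc m) \<in> \<gamma> ` {a..d}"
    by (rule curve_in_join[OF c1(1) c2(1)]) (use c1 c2 in auto)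
  then show False using VW(5)[OF iC, of \<gamma> a d] qn i(2,3)[of m] by auto
qed

text \<open>Follow the rest of the curve and then a timelike curve to \<open>K\<close>: a
  chronological past is a past set. In the theorem this keeps the short timelike curves that end in
  the given compact set inside \<open>scri_domain\<close>.\<close>

lemma timelike_past_curve:
  assumes c: "curve_in A (future_timelike g T) S \<gamma> a b" and S: "S \<subseteq> S'"
    and b: "\<gamma> b \<in> timelike_past A g T K S'" and t: "t \<in> {a..b}"
  shows "\<gamma> t \<in> timelike_past A g T K S'"
proof (cases "t = b")
  case True then show ?thesis using b by simp
next
  case False
  have "curve_in A (future_timelike g T) S \<gamma> t b"
    by (rule curve_in_subinterval[OF c]) (use t False in auto)
  then have c1: "curve_in A (future_timelike g T) S' \<gamma> t b" by (rule curve_in_mono[OF _ S])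
  obtain \<gamma>2 a' b' where c2: "curve_in A (future_timelike g T) S' \<gamma>2 a' b'" "\<gamma>2 a' = \<gamma> b" "\<gamma>2 b' \<in> K"
    using b unfolding timelike_past_def by blast
  obtain \<gamma>' d where "curve_in A (future_timelike g T) S' \<gamma>' t d" "\<gamma>' t = \<gamma> t" "\<gamma>' d = \<gamma>2 b'"
    by (rule curve_in_join[OF c1 c2(1)]) (use c2 in auto)
  then show ?thesis using c2(3) unfolding timelike_past_def by force
qed

theorem lemma2p4:
  fixes AM A :: "('a::{t2_space, second_countable_topology}, 'e::euclidean_space \<times> real) chart set"
    and g gt :: "('a, 'e \<times> real) bilinear_field"
    and T :: "('a, 'e \<times> real) vector_field"
    and \<Omega> :: "'a \<Rightarrow> real"
    and K :: "'a set"
  assumes "spacetime AM g T"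
    and "future_conformal_completion AM g T A gt \<Omega>"
    and "scri_plus A gt T \<noteq> {}"
    and "connected (scri_plus A gt T)"
    and "null_hypersurface A gt (scri_plus A gt T)"
    and "globally_hyperbolic A gt T (scri_domain A gt T \<union> scri_plus A gt T)"
    and "null_energy_condition AM g (scri_domain A gt T)"
    and "compact K"
    and "K \<subseteq> scri_domain A gt T"
  shows "\<not> scri_plus A gt T \<subseteq>
    causal_future A gt T K (scri_domain A gt T \<union> scri_plus A gt T)"
proof
  define N where "N = scri_plus A gt T"
  define D where "D = scri_domain A gt T"
  define S where "S = D \<union> N"
  assume "scri_plus A gt T \<subseteq> causal_future A gt T K (scri_domain A gt T \<union> scri_plus A gt T)"
  then have N_sub: "N \<subseteq> causal_future A gt T K S" by (simp add: N_def D_def S_def)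
  have KD: "K \<subseteq> D" using assms(9) by (simp add: D_def)
  have cc: "conformal_completion AM g T A gt \<Omega>" and carr: "carrier A = carrier AM \<union> N"
    using assms(2) unfolding future_conformal_completion_def N_def by blast+
  have A: "smooth_manifold A" and AM: "AM = open_submanifold A (minterior A)"
    and gt: "lorentzian_metric A gt" and T: "time_orientation A gt T"
    using cc unfolding conformal_completion_def by blast+
  have AM_A: "c \<in> A" "cdom c \<subseteq> minterior A" if "c \<in> AM" for c
    using that unfolding AM open_submanifold_def by blast+
  have N_bd: "N \<subseteq> mboundary A" unfolding N_def scri_plus_def by blast
  have D_int: "D \<subseteq> minterior A" unfolding D_def scri_domain_def by blast
  have AM_N: "carrier AM \<inter> N = {}"
    using AM_A(2) N_bd unfolding carrier_def minterior_def by blast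
  have D_AM: "D \<subseteq> carrier AM" using D_int carr N_bd unfolding minterior_def by blast
  \<comment> \<open>Charts of \<open>AM\<close> miss the edge of the half-space because
    \<open>mboundary AM\<close> is empty, so their images are open in the full space, as
    \<open>timelike_predecessor\<close> requires.\<close>
  have open_chart: "open (cimage c)" if c: "c \<in> AM" for c
  proof -
    have ch: "is_chart c" by (rule smooth_manifoldD(1)[OF A AM_A(1)[OF c]])
    have bd: "mboundary AM = {}" using assms(1) unfolding spacetime_def by blast
    obtain U where U: "open U" "cimage c = half_space \<inter> U"
      using ch unfolding is_chart_def openin_open by blast
    have "snd x \<noteq> 0" if x: "x \<in> cimage c" for x
    proof
      assume "snd x = 0"
      then have "cinv c x \<in> mboundary AM"
        using is_chart_cinv[OF ch x] c by (auto simp: mboundary_def)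
      then show False using bd by simp
    qed
    then have "snd x > 0" if "x \<in> cimage c" for x
      using that U(2) by (metis IntD1 half_space_def linorder_not_le mem_Collect_eq order_antisym_conv)
    then have "cimage c = snd -` {0<..} \<inter> U" using U(2) unfolding half_space_def by (auto simp: less_imp_le)
    then show ?thesis using U(1) by (auto intro!: open_Int open_vimage_snd)
  qed
  have "open (cdom c)" if "c \<in> AM" for c
    using smooth_manifoldD(1)[OF A AM_A(1)[OF that]] by (simp add: is_chart_def)
  then have open_AM: "open (carrier AM)" unfolding carrier_def by blast
  have tl_imp_causal: "future_causal gt T c p v" if "c \<in> A" "p \<in> cdom c" "future_timelike gt T c p v" for c p v
    using future_timelike_imp_future_causal lorentzian_metricD(2)[OF gt that(1,2)] that(3)
    unfolding lorentzian_form_def by metis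
  \<comment> \<open>\<open>q\<close> has to lie in \<open>D\<close> and the curves in
    \<open>S\<close>, since global hyperbolicity speaks only of futures and pasts taken within
    \<open>S\<close>.\<close>
  define good where "good k q V \<longleftrightarrow> open V \<and> k \<in> V \<and> q \<in> D \<and>
      (\<forall>y\<in>V \<inter> K. \<exists>\<gamma> a b. curve_in A (future_causal gt T) S \<gamma> a b \<and> \<gamma> a = q \<and> \<gamma> b = y)" for k q V
  have "\<exists>q V. good k q V" if k: "k \<in> K" for k
  proof -
    obtain c where c: "c \<in> AM" "k \<in> cdom c" using k KD D_AM unfolding carrier_def by blast
    obtain q V where V: "open V" "k \<in> V"
      "\<And>y. y \<in> V \<Longrightarrow> \<exists>\<gamma> a b. curve_in A (future_timelike gt T) (cdom c) \<gamma> a b \<and> \<gamma> a = q \<and> \<gamma> b = y"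
      using timelike_predecessor[OF A gt T AM_A(1)[OF c(1)] c(2) open_chart[OF c(1)]] by metis
    have curve: "\<exists>\<gamma> a b. curve_in A (future_causal gt T) S \<gamma> a b \<and> \<gamma> a = q \<and> \<gamma> b = y \<and> q \<in> D"
      if y: "y \<in> V \<inter> K" for y
    proof -
      obtain \<gamma> a b where \<gamma>: "curve_in A (future_timelike gt T) (cdom c) \<gamma> a b" "\<gamma> a = q" "\<gamma> b = y"
        using V(3) y by blast
      have sub: "cdom c \<subseteq> carrier A" using AM_A(1)[OF c(1)] unfolding carrier_def by blast
      have "\<gamma> b \<in> timelike_past A gt T N (carrier A)"
        using y KD \<gamma>(3) unfolding D_def scri_domain_def N_def by blast
      from timelike_past_curve[OF \<gamma>(1) sub this]
      have past: "\<gamma> t \<in> timelike_past A gt T N (carrier A)" if "t \<in> {a..b}" for t using that .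
      have img: "\<gamma> t \<in> cdom c" if "t \<in> {a..b}" for t using \<gamma>(1) that unfolding curve_in_def by blast
      have inD: "\<gamma> t \<in> D" if "t \<in> {a..b}" for t
        using past[OF that] img[OF that] AM_A(2)[OF c(1)] unfolding D_def scri_domain_def N_def by blast
      have "curve_in A (future_timelike gt T) S \<gamma> a b"
        using \<gamma>(1) inD unfolding curve_in_def S_def by blast
      then have "curve_in A (future_causal gt T) S \<gamma> a b"
        by (rule curve_in_mono) (use tl_imp_causal in auto)
      moreover have "q \<in> D" using inD[of a] \<gamma>(1,2) unfolding curve_in_def by simp
      ultimately show ?thesis using \<gamma>(2,3) by blast
    qed
    have "q \<in> D" using curve[of k] V(2) k by blast
    have "good k q V"
      unfolding good_def
    proof (intro conjI ballI)
      fix y assume "y \<in> V \<inter> K"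
      from curve[OF this]
      show "\<exists>\<gamma> a b. curve_in A (future_causal gt T) S \<gamma> a b \<and> \<gamma> a = q \<and> \<gamma> b = y" by fast
    qed (fact V \<open>q \<in> D\<close>)+
    then show ?thesis by (intro exI)
  qed
  then obtain Q V where good: "\<And>k. k \<in> K \<Longrightarrow> good k (Q k) (V k)" by metis
  have QV: "k \<in> K \<Longrightarrow> open (V k)" "k \<in> K \<Longrightarrow> k \<in> V k" "k \<in> K \<Longrightarrow> Q k \<in> D"
    "\<And>y. k \<in> K \<Longrightarrow> y \<in> V k \<inter> K \<Longrightarrow> \<exists>\<gamma> a b. curve_in A (future_causal gt T) S \<gamma> a b \<and> \<gamma> a = Q k \<and> \<gamma> b = y" for k
    using good[of k] unfolding good_def by blast+
  obtain J where J: "J \<subseteq> K" "finite J" "K \<subseteq> (\<Union>k\<in>J. V k)"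
    by (rule compactE_image[OF assms(8), of K V]) (use QV(1,2) in auto)
  obtain p where p: "p \<in> N" using assms(3) by (auto simp: N_def)
  \<comment> \<open>Removing the open interior preserves compactness and leaves only points of
    \<open>N\<close>, at which \<open>null_generator_leaves\<close> applies.\<close>
  define C where "C = (\<Union>k\<in>J. causal_future A gt T {Q k} S \<inter> causal_past A gt T {p} S) - carrier AM"
  define E where "E = N \<inter> causal_past A gt T {p} S"
  have gh: "strongly_causal A gt T S"
    "\<And>x y. x \<in> S \<Longrightarrow> y \<in> S \<Longrightarrow> compact (causal_future A gt T {x} S \<inter> causal_past A gt T {y} S)"
    using assms(6) unfolding globally_hyperbolic_def S_def D_def N_def by blast+
  have "Q k \<in> S" if "k \<in> J" for k using QV(3) J(1) that unfolding S_def by blast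
  moreover have "p \<in> S" using p by (simp add: S_def)
  ultimately have "compact (\<Union>k\<in>J. causal_future A gt T {Q k} S \<inter> causal_past A gt T {p} S)"
    by (intro compact_UN J(2) gh(2))
  then have C: "compact C" unfolding C_def by (rule compact_diff[OF _ open_AM])
  have "causal_past A gt T {p} S \<subseteq> S"
  proof
    fix z assume z: "z \<in> causal_past A gt T {p} S"
    show "z \<in> S"
    proof (cases "z = p")
      case False
      then obtain \<gamma> a b where "curve_in A (future_causal gt T) S \<gamma> a b" "\<gamma> a = z"
        using z unfolding causal_past_def by blast
      then have "\<gamma> ` {a..b} \<subseteq> S" "a \<in> {a..b}" by (auto simp: curve_in_def)
      then show ?thesis using \<open>\<gamma> a = z\<close> by blast
    qed (simp add: \<open>p \<in> S\<close>)
  qed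
  then have CN: "C \<subseteq> N" unfolding C_def S_def using D_AM by blast
  have EC: "E \<subseteq> C"
  proof
    fix z assume z: "z \<in> E"
    then have zN: "z \<in> N" and zp: "z \<in> causal_past A gt T {p} S" by (auto simp: E_def)
    \<comment> \<open>Excludes the trivial part of the causal future of \<open>K\<close>, so that a
      genuine curve arrives at \<open>z\<close>.\<close>
    have "z \<notin> K" using zN KD D_AM AM_N by blast
    then obtain \<gamma>2 a' b' where c2: "curve_in A (future_causal gt T) S \<gamma>2 a' b'" "\<gamma>2 a' \<in> K" "\<gamma>2 b' = z"
      using N_sub zN unfolding causal_future_def by blast
    then obtain k where k: "k \<in> J" "\<gamma>2 a' \<in> V k" using J(3) by blast
    then obtain \<gamma>1 a b where c1: "curve_in A (future_causal gt T) S \<gamma>1 a b" "\<gamma>1 a = Q k" "\<gamma>1 b = \<gamma>2 a'"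
      using QV(4)[of k "\<gamma>2 a'"] J(1) c2(2) by blast
    obtain \<gamma> d where "curve_in A (future_causal gt T) S \<gamma> a d" "\<gamma> a = Q k" "\<gamma> d = z"
      by (rule curve_in_join[OF c1(1) c2(1) c1(3)]) (use c1 c2 in auto)
    then have "z \<in> causal_future A gt T {Q k} S" unfolding causal_future_def by blast
    then show "z \<in> C" using k(1) zp zN AM_N unfolding C_def by blast
  qed
  show False
  proof (rule strongly_causal_leaving_sequence[OF gh(1) C _ EC])
    show "C \<subseteq> S" using CN unfolding S_def by blast
    show "p \<in> E" using p by (simp add: E_def causal_past_def)
    fix z assume "z \<in> C"
    then have z: "z \<in> N" using CN by blast
    obtain W where W: "open W" "z \<in> W" "\<And>r. r \<in> N \<inter> W \<Longrightarrow> \<exists>\<gamma> a b.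
        curve_in A (future_causal gt T) N \<gamma> a b \<and> \<gamma> a \<notin> W \<and> \<gamma> b = r"
      using null_generator_leaves[OF A gt T assms(5)[folded N_def] z] by metis
    have "\<exists>\<gamma> a b. curve_in A (future_causal gt T) S \<gamma> a b \<and> \<gamma> a \<in> E - W \<and> \<gamma> b = r"
      if r: "r \<in> E \<inter> W" for r
    proof -
      have "r \<in> N \<inter> W" using r by (auto simp: E_def)
      from W(3)[OF this] obtain \<gamma> a b where
        \<gamma>: "curve_in A (future_causal gt T) N \<gamma> a b" "\<gamma> a \<notin> W" "\<gamma> b = r" by blast
      have \<gamma>S: "curve_in A (future_causal gt T) S \<gamma> a b"
        by (rule curve_in_mono[OF \<gamma>(1)]) (auto simp: S_def)
      have "\<gamma> ` {a..b} \<subseteq> N" "a \<in> {a..b}" using \<gamma>(1) by (auto simp: curve_in_def)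
      then have aN: "\<gamma> a \<in> N" by blast
      \<comment> \<open>The generator segment lies in \<open>S\<close> and can be prolonged from
        \<open>r\<close> to \<open>p\<close>, so going back along it does not leave
        \<open>E\<close>.\<close>
      have "\<gamma> a \<in> causal_past A gt T {p} S"
      proof (cases "r = p")
        case True
        then show ?thesis using \<gamma>S \<gamma>(3) unfolding causal_past_def by blast
      next
        case False
        have "r \<in> causal_past A gt T {p} S" using r by (simp add: E_def)
        then obtain \<gamma>2 a' b' where c2: "curve_in A (future_causal gt T) S \<gamma>2 a' b'" "\<gamma>2 a' = r" "\<gamma>2 b' = p"
          using False unfolding causal_past_def by blast
        obtain \<gamma>' d where "curve_in A (future_causal gt T) S \<gamma>' a d" "\<gamma>' a = \<gamma> a" "\<gamma>' d = p"
          by (rule curve_in_join[OF \<gamma>S c2(1)]) (use c2 \<gamma>(3) in auto)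
        then show ?thesis unfolding causal_past_def by blast
      qed
      then show ?thesis using \<gamma>S \<gamma>(2,3) aN unfolding E_def by blast
    qed
    then show "\<exists>W. open W \<and> z \<in> W \<and> (\<forall>r\<in>E \<inter> W. \<exists>\<gamma> a b.
        curve_in A (future_causal gt T) S \<gamma> a b \<and> \<gamma> a \<in> E - W \<and> \<gamma> b = r)"
      using W(1,2) by blast
  qed
qed

end
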